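(* Let $\gamma>0$ be irrational and let $\mathbb{H}_{\gamma}=\{(z_1,z_2)\in\mathbb{C}^2:|z_1|^{\gamma}<|z_2|<1\}$. The Bergman projection $\mathbf{B}_{\gamma}$ of $\mathbb{H}_\gamma$ is a bounded operator from $L^p(\mathbb{H}_{\gamma})$ to $A^p(\mathbb{H}_{\gamma})$ if and only if $p=2$.
   Context: For a domain $\Omega\subset\mathbb{C}^2$, $L^p(\Omega)$ is taken with respect to Lebesgue measure $dV$, and $A^p(\Omega)=\mathcal{O}(\Omega)\cap L^p(\Omega)$. The Bergman projection $\mathbf{B}_\Omega$ is the orthogonal projection $L^2(\Omega)\to A^2(\Omega)$; it is given by $\mathbf{B}_\Omega f(z)=\int_\Omega \mathbb{B}_\Omega(z,w)f(w)\,dV(w)$ with $\mathbb{B}_\Omega$ the Bergman kernel, and this integral formula is used to define $\mathbf{B}_\Omega$ on $L^p(\Omega)$ whenever the integral is defined. Throughout, $p\in(1,\infty)$. *)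

theory Defs
  imports "HOL-Analysis.Analysis"
begin

definition scaleC2 :: "complex \<Rightarrow> complex \<times> complex \<Rightarrow> complex \<times> complex" where
  "scaleC2 c v = (c * fst v, c * snd v)"

definition holo2 :: "(complex \<times> complex \<Rightarrow> complex) \<Rightarrow> (complex \<times> complex) set \<Rightarrow> bool" where
  "holo2 f \<Omega> \<longleftrightarrow> (\<forall>z\<in>\<Omega>. \<exists>L. (f has_derivative L) (at z) \<and>
       (\<forall>c v. L (scaleC2 c v) = c * L v))"

definition Lp :: "real \<Rightarrow> (complex \<times> complex) set \<Rightarrow> (complex \<times> complex \<Rightarrow> complex) \<Rightarrow> bool" where
  "Lp p \<Omega> f \<longleftrightarrow> f \<in> borel_measurable (lebesgue_on \<Omega>) \<and>
     integrable (lebesgue_on \<Omega>) (\<lambda>w. norm (f w) powr p)"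

definition Lp_norm :: "real \<Rightarrow> (complex \<times> complex) set \<Rightarrow> (complex \<times> complex \<Rightarrow> complex) \<Rightarrow> real" where
  "Lp_norm p \<Omega> f = (\<integral>w. norm (f w) powr p \<partial>lebesgue_on \<Omega>) powr (1 / p)"

definition Ap :: "real \<Rightarrow> (complex \<times> complex) set \<Rightarrow> (complex \<times> complex \<Rightarrow> complex) \<Rightarrow> bool" where
  "Ap p \<Omega> f \<longleftrightarrow> holo2 f \<Omega> \<and> Lp p \<Omega> f"

text \<open>Bergman kernel: K(z,w) = conj(k_z(w)) where k_z \<in> A^2 (extended by 0 off Omega)
  is the reproducing element: h(z) = <h, k_z> for all h \<in> A^2. Then the Bergman
  projection (orthogonal projection onto A^2) is f \<mapsto> \<integral> K(z,w) f(w) dV(w).\<close>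
definition bergman_kernel :: "(complex \<times> complex) set \<Rightarrow> complex \<times> complex \<Rightarrow> complex \<times> complex \<Rightarrow> complex" where
  "bergman_kernel \<Omega> z w = cnj ((THE k. Ap 2 \<Omega> k \<and> (\<forall>u. u \<notin> \<Omega> \<longrightarrow> k u = 0) \<and>
      (\<forall>h. Ap 2 \<Omega> h \<longrightarrow> h z = (\<integral>u. h u * cnj (k u) \<partial>lebesgue_on \<Omega>))) w)"

definition bergman_proj :: "(complex \<times> complex) set \<Rightarrow> (complex \<times> complex \<Rightarrow> complex) \<Rightarrow> complex \<times> complex \<Rightarrow> complex" where
  "bergman_proj \<Omega> f z = (\<integral>w. bergman_kernel \<Omega> z w * f w \<partial>lebesgue_on \<Omega>)"

definition bergman_Lp_bounded :: "real \<Rightarrow> (complex \<times> complex) set \<Rightarrow> bool" where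
  "bergman_Lp_bounded p \<Omega> \<longleftrightarrow> (\<exists>C. \<forall>f. Lp p \<Omega> f \<longrightarrow>
     (\<forall>z\<in>\<Omega>. integrable (lebesgue_on \<Omega>) (\<lambda>w. bergman_kernel \<Omega> z w * f w)) \<and>
     Ap p \<Omega> (bergman_proj \<Omega> f) \<and>
     Lp_norm p \<Omega> (bergman_proj \<Omega> f) \<le> C * Lp_norm p \<Omega> f)"

definition Hgamma :: "real \<Rightarrow> (complex \<times> complex) set" where
  "Hgamma \<gamma> = {(z1, z2). norm z1 powr \<gamma> < norm z2 \<and> norm z2 < 1}"

end

theory Submission
  imports Defs "HOL-Complex_Analysis.Complex_Analysis"
begin

text \<open>
  For any open set, \<open>B\<close> is the orthogonal projection of \<open>L\<^sup>2\<close> onto \<open>A\<^sup>2\<close>, hence a contraction. Point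
  evaluations are locally bounded on \<open>A\<^sup>2\<close> by the mean value property, so \<open>A\<^sup>2\<close> is complete, and Riesz
  representation yields both the kernel (from evaluations) and \<open>B f\<close> (from \<open>\<langle>\<cdot>, f\<rangle>\<close>).

  On \<open>H\<^sub>\<gamma>\<close> averaging over the torus shows that integrating a holomorphic function against
  \<open>cnj (w\<^sup>\<alpha>)\<close> times a torus-invariant weight \<open>\<rho>\<close> only sees one Laurent coefficient:
  the integral is \<open>C\<close> times that of \<open>|w\<^sup>\<alpha>|\<^sup>2 \<rho>\<close>, with \<open>C\<close> independent of \<open>\<rho>\<close>.
  The power \<open>|w\<^sup>\<alpha>|\<^sup>r\<close>, \<open>\<alpha> = (a, b)\<close>, is integrable iff \<open>r (a + b \<gamma>) > - 2 \<gamma> - 2\<close>. As \<open>\<gamma>\<close> is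
  irrational, Kronecker's theorem gives monomials \<open>w\<^sup>\<alpha>\<close> whose critical exponent \<open>q\<close> is larger than 2
  but as close to 2 as desired. If \<open>q < p\<close>, the bounded function \<open>w\<^sup>\<alpha> / |w\<^sup>\<alpha>|\<close> is projected to a
  nonzero multiple of \<open>w\<^sup>\<alpha>\<close>, which is not in \<open>L\<^sup>p\<close>. If \<open>p < 2\<close> and \<open>q\<close> is smaller than the conjugate
  exponent of \<open>p\<close>, then \<open>f = |w\<^sup>\<alpha>|\<^bsup>q-1\<^esup>\<close> is in \<open>L\<^sup>p\<close>, but integrability of the kernel times \<open>f\<close> would
  make \<open>|w\<^sup>\<alpha>|\<^sup>q\<close> integrable.
\<close>

section \<open>Rotation invariance of Lebesgue measure on \<open>\<complex>\<^sup>2\<close>\<close>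

lemma measurable_Complex [measurable]:
  assumes [measurable]: "f \<in> borel_measurable M" "g \<in> borel_measurable M"
  shows "(\<lambda>x. Complex (f x) (g x)) \<in> borel_measurable M"
  unfolding Complex_eq by measurable

text \<open>Lebesgue measure is determined by its values on boxes, and a complex box is a product of
  two real intervals. This makes Fubini available in the coordinates \<open>Re\<close> and
  \<open>Im\<close>.\<close>

lemma lborel_complex_eq_distr:
  "(lborel :: complex measure) = distr (lborel \<Otimes>\<^sub>M lborel) borel (\<lambda>(x, y). Complex x y)"
proof (rule lborel_eqI)
  fix l u :: complex
  assume "\<And>b. b \<in> Basis \<Longrightarrow> l \<bullet> b \<le> u \<bullet> b"
  from this[of 1] this[of \<i>] have le: "Re l \<le> Re u" "Im l \<le> Im u"
    by (auto simp: Basis_complex_def)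
  have "(\<lambda>(x, y). Complex x y) -` box l u \<inter> space (lborel \<Otimes>\<^sub>M lborel)
      = {Re l<..<Re u} \<times> {Im l<..<Im u}"
    by (auto simp: box_def Basis_complex_def space_pair_measure)
  then show "emeasure (distr (lborel \<Otimes>\<^sub>M lborel) borel (\<lambda>(x, y). Complex x y)) (box l u)
      = (\<Prod>b\<in>Basis. (u - l) \<bullet> b)"
    using le by (subst emeasure_distr) (auto simp: lborel.emeasure_pair_measure_Times
        Basis_complex_def ennreal_mult)
qed simp

lemma nn_integral_lborel_complex:
  assumes [measurable]: "f \<in> borel_measurable borel"
  shows "(\<integral>\<^sup>+z. f z \<partial>lborel) = (\<integral>\<^sup>+y. \<integral>\<^sup>+x. f (Complex x y) \<partial>lborel \<partial>lborel)"
    and "(\<integral>\<^sup>+z. f z \<partial>lborel) = (\<integral>\<^sup>+x. \<integral>\<^sup>+y. f (Complex x y) \<partial>lborel \<partial>lborel)"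
proof -
  have *: "(\<integral>\<^sup>+z. f z \<partial>lborel) = (\<integral>\<^sup>+z. f (case z of (x, y) \<Rightarrow> Complex x y) \<partial>(lborel \<Otimes>\<^sub>M lborel))"
    by (subst lborel_complex_eq_distr) (simp add: nn_integral_distr)
  show "(\<integral>\<^sup>+z. f z \<partial>lborel) = (\<integral>\<^sup>+y. \<integral>\<^sup>+x. f (Complex x y) \<partial>lborel \<partial>lborel)"
    unfolding * by (subst lborel_pair.nn_integral_snd[symmetric]) auto
  show "(\<integral>\<^sup>+z. f z \<partial>lborel) = (\<integral>\<^sup>+x. \<integral>\<^sup>+y. f (Complex x y) \<partial>lborel \<partial>lborel)"
    unfolding * by (subst lborel.nn_integral_fst[symmetric]) auto
qed

text \<open>A rotation is split into two affine substitutions in one real variable each: first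
  \<open>x\<close> is replaced by \<open>c * x - s * y\<close> with \<open>y\<close> fixed, then
  \<open>y\<close> by \<open>s * x / c + y / c\<close> with the new \<open>x\<close> fixed. Their
  Jacobians \<open>\<bar>c\<bar>\<close> and \<open>1 / \<bar>c\<bar>\<close> cancel, which requires
  \<open>c\<close> to be nonzero.\<close>

lemma nn_integral_rotate_aux:
  fixes u :: complex
  assumes [measurable]: "f \<in> borel_measurable borel" and u: "norm u = 1" "Re u \<noteq> 0"
  shows "(\<integral>\<^sup>+z. f (u * z) \<partial>lborel) = (\<integral>\<^sup>+z. f z \<partial>lborel)"
proof -
  define c s where "c = Re u" and "s = Im u"
  have cs: "c\<^sup>2 + s\<^sup>2 = 1" "c \<noteq> 0" and u_eq: "u = Complex c s"
    using u by (auto simp: c_def s_def cmod_def)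
  \<comment> \<open>This writes the imaginary part of the rotated point in terms of its real part
    \<open>c * x - s * y\<close> and the old \<open>y\<close>.\<close>
  have e: "s * (c * x - s * y) / c + y / c = s * x + c * y" for x y
  proof -
    have "s * (c * x - s * y) + y = c * (s * x + c * y)"
      using cs(1) by algebra
    then show ?thesis
      using cs(2) by (simp add: field_simps)
  qed
  have "ennreal \<bar>c\<bar> * (\<integral>\<^sup>+z. f (u * z) \<partial>lborel)
      = (\<integral>\<^sup>+y. ennreal \<bar>c\<bar> * (\<integral>\<^sup>+x. f (u * Complex x y) \<partial>lborel) \<partial>lborel)"
    by (subst nn_integral_lborel_complex(1)) (simp_all add: nn_integral_cmult)
  also have "\<dots> = (\<integral>\<^sup>+y. \<integral>\<^sup>+x. f (Complex x (s * x / c + y / c)) \<partial>lborel \<partial>lborel)"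
  proof (rule nn_integral_cong)
    fix y
    show "ennreal \<bar>c\<bar> * (\<integral>\<^sup>+x. f (u * Complex x y) \<partial>lborel)
        = (\<integral>\<^sup>+x. f (Complex x (s * x / c + y / c)) \<partial>lborel)"
    proof (subst (2) nn_integral_real_affine[where c=c and t="- s * y"])
      have "f (u * Complex x y) = f (Complex (- s * y + c * x) (s * (- s * y + c * x) / c + y / c))" for x
        using e[of x y] by (simp add: u_eq complex_mult algebra_simps)
      then show "ennreal \<bar>c\<bar> * (\<integral>\<^sup>+x. f (u * Complex x y) \<partial>lborel) = ennreal \<bar>c\<bar> *
          (\<integral>\<^sup>+x. f (Complex (- s * y + c * x) (s * (- s * y + c * x) / c + y / c)) \<partial>lborel)"
        by simp
    qed (use cs(2) in auto)
  qed
  also have "\<dots> = (\<integral>\<^sup>+x. \<integral>\<^sup>+y. f (Complex x (s * x / c + y / c)) \<partial>lborel \<partial>lborel)"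
    by (rule lborel_pair.Fubini') measurable
  also have "\<dots> = (\<integral>\<^sup>+x. ennreal \<bar>c\<bar> * (\<integral>\<^sup>+y. f (Complex x y) \<partial>lborel) \<partial>lborel)"
  proof (rule nn_integral_cong)
    fix x
    have "(\<integral>\<^sup>+y. f (Complex x y) \<partial>lborel)
        = ennreal \<bar>1 / c\<bar> * (\<integral>\<^sup>+y. f (Complex x (s * x / c + y / c)) \<partial>lborel)"
      using cs(2) by (subst nn_integral_real_affine[where c="1/c" and t="s * x / c"]) auto
    then show "(\<integral>\<^sup>+y. f (Complex x (s * x / c + y / c)) \<partial>lborel)
        = ennreal \<bar>c\<bar> * (\<integral>\<^sup>+y. f (Complex x y) \<partial>lborel)"
      using cs(2) by (simp add: mult.assoc[symmetric] ennreal_mult[symmetric])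
  qed
  also have "\<dots> = ennreal \<bar>c\<bar> * (\<integral>\<^sup>+z. f z \<partial>lborel)"
    by (subst nn_integral_lborel_complex(2)) (simp_all add: nn_integral_cmult)
  finally show ?thesis
    using cs(2) by (simp add: ennreal_mult_cancel_left)
qed

text \<open>The exceptional case \<open>Re u = 0\<close> is reached by rotating twice by a square root of \<open>u\<close>.\<close>

lemma nn_integral_rotate:
  fixes u :: complex
  assumes [measurable]: "f \<in> borel_measurable borel" and u: "norm u = 1"
  shows "(\<integral>\<^sup>+z. f (u * z) \<partial>lborel) = (\<integral>\<^sup>+z. f z \<partial>lborel)"
proof (cases "Re u = 0")
  case True
  define v where "v = csqrt u"
  have v: "v * v = u"
    unfolding v_def by (metis power2_csqrt power2_eq_square)
  then have "norm v * norm v = 1"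
    using u by (metis norm_mult)
  then have nv: "norm v = 1"
    by (metis norm_ge_zero abs_of_nonneg real_sqrt_abs2 real_sqrt_one)
  have rv: "Re v \<noteq> 0"
  proof
    assume "Re v = 0"
    then have "Im u = 0"
      using v by (metis add_0 mult_zero_left mult_zero_right times_complex.sel(2))
    then show False
      using True u by (simp add: cmod_def)
  qed
  have "(\<integral>\<^sup>+z. f (u * z) \<partial>lborel) = (\<integral>\<^sup>+z. f (v * (v * z)) \<partial>lborel)"
    by (simp add: v[symmetric] mult.assoc)
  also have "\<dots> = (\<integral>\<^sup>+z. f (v * z) \<partial>lborel)"
    by (rule nn_integral_rotate_aux[OF _ nv rv, of "\<lambda>z. f (v * z)"]) measurable
  also have "\<dots> = (\<integral>\<^sup>+z. f z \<partial>lborel)"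
    by (rule nn_integral_rotate_aux[OF _ nv rv]) measurable
  finally show ?thesis .
qed (use nn_integral_rotate_aux assms in blast)

lemma nn_integral_rotate_C2:
  fixes u v :: complex and f :: "complex \<times> complex \<Rightarrow> ennreal"
  assumes [measurable]: "f \<in> borel_measurable borel" and u: "norm u = 1" "norm v = 1"
  shows "(\<integral>\<^sup>+z. f (u * fst z, v * snd z) \<partial>lborel) = (\<integral>\<^sup>+z. f z \<partial>lborel)"
proof -
  have [measurable]: "f \<in> borel_measurable (borel \<Otimes>\<^sub>M borel)"
    by (simp add: borel_prod)
  have "(\<integral>\<^sup>+z. f (u * fst z, v * snd z) \<partial>lborel)
      = (\<integral>\<^sup>+x. \<integral>\<^sup>+y. f (u * x, v * y) \<partial>lborel \<partial>lborel)"
    by (simp add: lborel_prod[symmetric] lborel.nn_integral_fst[symmetric])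
  also have "\<dots> = (\<integral>\<^sup>+x. \<integral>\<^sup>+y. f (u * x, y) \<partial>lborel \<partial>lborel)"
    by (intro nn_integral_cong nn_integral_rotate[OF _ u(2), of "\<lambda>y. f (u * _, y)"]) measurable
  also have "\<dots> = (\<integral>\<^sup>+x. \<integral>\<^sup>+y. f (x, y) \<partial>lborel \<partial>lborel)"
    by (rule nn_integral_rotate[OF _ u(1), of "\<lambda>x. \<integral>\<^sup>+y. f (x, y) \<partial>lborel"]) measurable
  also have "\<dots> = (\<integral>\<^sup>+z. f z \<partial>lborel)"
    by (simp add: lborel_prod[symmetric] lborel.nn_integral_fst[symmetric])
  finally show ?thesis .
qed

lemma lborel_rotate_C2:
  fixes u v :: complex
  assumes "norm u = 1" "norm v = 1"
  shows "distr lborel borel (\<lambda>z. (u * fst z, v * snd z)) = (lborel :: (complex \<times> complex) measure)"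
proof (rule measure_eqI)
  fix A :: "(complex \<times> complex) set"
  assume "A \<in> sets (distr lborel borel (\<lambda>z. (u * fst z, v * snd z)))"
  then have [measurable]: "A \<in> sets borel" by simp
  have m: "(\<lambda>z. (u * fst z, v * snd z)) \<in> borel \<rightarrow>\<^sub>M borel"
    by (intro borel_measurable_continuous_onI continuous_intros)
  show "emeasure (distr lborel borel (\<lambda>z. (u * fst z, v * snd z))) A = emeasure lborel A"
    using nn_integral_rotate_C2[OF borel_measurable_indicator assms, of A] m
    by (simp add: nn_integral_distr flip: nn_integral_indicator)
qed simp

section \<open>Averaging over a measure-preserving family\<close>

text \<open>Fubini on the product with the unit interval, which has mass 1: by invariance every
  slice integral over \<open>w\<close> equals the integral of \<open>H\<close>, so averaging them
  over \<open>t\<close> changes nothing.\<close>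

lemma integral_average:
  fixes H :: "'a::euclidean_space \<Rightarrow> complex" and T :: "real \<Rightarrow> 'a \<Rightarrow> 'a"
  assumes T: "(\<lambda>(t, w). T t w) \<in> borel \<Otimes>\<^sub>M borel \<rightarrow>\<^sub>M borel"
    and inv: "\<And>t. distr lborel borel (T t) = lborel"
    and H: "integrable lborel H"
  defines "I \<equiv> restrict_space lborel {0..1::real}"
  shows "integrable lborel (\<lambda>w. \<integral>t. H (T t w) \<partial>I)"
    and "(\<integral>w. (\<integral>t. H (T t w) \<partial>I) \<partial>lborel) = (\<integral>w. H w \<partial>lborel)"
proof -
  have eI: "emeasure I (space I) = 1"
    unfolding I_def by (simp add: emeasure_restrict_space space_restrict_space)
  interpret I: finite_measure I
    by (rule finite_measureI) (simp add: eI)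
  interpret P: pair_sigma_finite I "lborel :: 'a measure" ..
  have [measurable]: "H \<in> borel_measurable borel"
    using H by simp
  have idm: "(\<lambda>t. t) \<in> I \<rightarrow>\<^sub>M borel"
    unfolding I_def by (simp add: measurable_restrict_space1)
  have m1: "(\<lambda>z. (fst z, snd z)) \<in> I \<Otimes>\<^sub>M lborel \<rightarrow>\<^sub>M borel \<Otimes>\<^sub>M borel"
    by (intro measurable_Pair measurable_compose[OF measurable_fst idm]) simp
  have m2: "(\<lambda>z. T (fst z) (snd z)) \<in> I \<Otimes>\<^sub>M lborel \<rightarrow>\<^sub>M borel"
    using measurable_compose[OF m1 T] by simp
  have m[measurable]: "(\<lambda>(t, w). H (T t w)) \<in> borel_measurable (I \<Otimes>\<^sub>M lborel)"
    using m2 by (simp add: split_beta')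
  have Tm[measurable]: "T t \<in> borel \<rightarrow>\<^sub>M borel" for t
    using measurable_compose[OF measurable_Pair1' T, of t] by simp
  have 1: "(\<integral>\<^sup>+w. norm (H (T t w)) \<partial>lborel) = (\<integral>\<^sup>+w. norm (H w) \<partial>lborel)" for t
    by (subst inv[of t, symmetric]) (simp add: nn_integral_distr)
  have Hf: "(\<integral>\<^sup>+w. norm (H w) \<partial>lborel) < \<infinity>"
    using H by (simp add: integrable_iff_bounded)
  \<comment> \<open>By Tonelli, the integral of the norm over the product is an average of equal
    slice integrals, hence finite.\<close>
  have int: "integrable (I \<Otimes>\<^sub>M lborel) (\<lambda>(t, w). H (T t w))"
    unfolding integrable_iff_bounded
  proof
    have "(\<integral>\<^sup>+x. norm (case x of (t, w) \<Rightarrow> H (T t w)) \<partial>(I \<Otimes>\<^sub>M lborel))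
        = (\<integral>\<^sup>+t. \<integral>\<^sup>+w. norm (H (T t w)) \<partial>lborel \<partial>I)"
      by (subst lborel.nn_integral_fst[symmetric]) (auto simp: split_beta')
    also have "\<dots> = (\<integral>\<^sup>+w. norm (H w) \<partial>lborel)"
      using eI by (simp add: 1)
    finally show "(\<integral>\<^sup>+x. norm (case x of (t, w) \<Rightarrow> H (T t w)) \<partial>(I \<Otimes>\<^sub>M lborel)) < \<infinity>"
      using Hf by simp
  qed measurable
  show "integrable lborel (\<lambda>w. \<integral>t. H (T t w) \<partial>I)"
    using P.integrable_snd[OF int] by simp
  have "(\<integral>w. (\<integral>t. H (T t w) \<partial>I) \<partial>lborel) = (\<integral>t. (\<integral>w. H (T t w) \<partial>lborel) \<partial>I)"
    using P.Fubini_integral[OF int] by simp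
  also have "\<dots> = (\<integral>t. (\<integral>w. H w \<partial>lborel) \<partial>I)"
  proof (rule Bochner_Integration.integral_cong[OF refl])
    fix t
    show "(\<integral>w. H (T t w) \<partial>lborel) = (\<integral>w. H w \<partial>lborel)"
      by (subst (2) inv[of t, symmetric]) (simp add: integral_distr)
  qed
  also have "\<dots> = (\<integral>w. H w \<partial>lborel)"
    using eI by (simp add: measure_def)
  finally show "(\<integral>w. (\<integral>t. H (T t w) \<partial>I) \<partial>lborel) = (\<integral>w. H w \<partial>lborel)" .
qed

section \<open>The mean value property\<close>

definition ecirc :: "real \<Rightarrow> complex" where
  "ecirc t = exp (2 * of_real pi * \<i> * of_real t)"

lemma norm_ecirc [simp]: "norm (ecirc t) = 1"
  by (simp add: ecirc_def)

lemma ecirc_nonzero [simp]: "ecirc t \<noteq> 0"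
  by (simp add: ecirc_def)

lemma continuous_on_ecirc [continuous_intros]:
  "continuous_on S f \<Longrightarrow> continuous_on S (\<lambda>x. ecirc (f x))"
  unfolding ecirc_def by (intro continuous_intros)

abbreviation unit_itv :: "real measure" where
  "unit_itv \<equiv> restrict_space lborel {0..1}"

lemma integral_unit_itv:
  fixes f :: "real \<Rightarrow> complex"
  assumes "continuous_on {0..1} f"
  shows "(\<integral>t. f t \<partial>unit_itv) = integral {0..1} f"
proof -
  have "set_integrable lborel {0..1} f"
    using borel_integrable_compact[OF compact_Icc assms] by (simp add: set_integrable_def)
  then show ?thesis
    using set_borel_integral_eq_integral(2)[of "{0..1}" f]
    by (simp add: integral_restrict_space set_lebesgue_integral_def)
qed

text \<open>Cauchy's integral formula at the centre of the unit circle, with the contour integral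
  written out in the parameter \<open>t\<close>.\<close>

lemma circle_mean_value:
  assumes "f holomorphic_on cball 0 1"
  shows "integral {0..1} (\<lambda>t. f (ecirc t)) = f 0"
proof -
  have ec: "circlepath 0 1 t = ecirc t" for t
    by (simp add: circlepath ecirc_def)
  have "((\<lambda>u. f u / (u - 0)) has_contour_integral (2 * of_real pi * \<i> * f 0)) (circlepath 0 1)"
    by (rule Cauchy_integral_circlepath_simple[OF assms]) simp
  then have "((\<lambda>t. f (ecirc t) * (2 * of_real pi * \<i>)) has_integral (2 * of_real pi * \<i> * f 0)) {0..1}"
    unfolding has_contour_integral_def
    by (rule has_integral_cong[THEN iffD1, rotated])
       (simp add: vector_derivative_circlepath01 ec flip: ecirc_def)
  then have "((\<lambda>t. f (ecirc t) * (2 * of_real pi * \<i>) / (2 * of_real pi * \<i>))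
      has_integral (2 * of_real pi * \<i> * f 0) / (2 * of_real pi * \<i>)) {0..1}"
    by (rule has_integral_divide)
  then show ?thesis
    by (intro integral_unique) simp
qed

lemma holo2_has_derivativeE:
  assumes "holo2 f \<Omega>" "z \<in> \<Omega>"
  obtains L where "(f has_derivative L) (at z)" "\<And>c v. L (scaleC2 c v) = c * L v"
  using assms unfolding holo2_def by blast

lemma holo2_imp_continuous_on:
  assumes "holo2 f \<Omega>"
  shows "continuous_on \<Omega> f"
  by (meson assms continuous_at_imp_continuous_on has_derivative_continuous holo2_def)

lemma holo2_subset: "holo2 f \<Omega> \<Longrightarrow> S \<subseteq> \<Omega> \<Longrightarrow> holo2 f S"
  by (auto simp: holo2_def)

lemma holo2_cong:
  assumes "open \<Omega>" "\<And>z. z \<in> \<Omega> \<Longrightarrow> f z = g z"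
  shows "holo2 f \<Omega> \<longleftrightarrow> holo2 g \<Omega>"
proof -
  have "(f has_derivative L) (at z) \<longleftrightarrow> (g has_derivative L) (at z)" if "z \<in> \<Omega>" for z L
    using has_derivative_transform_within_open[of f L z UNIV \<Omega> g]
      has_derivative_transform_within_open[of g L z UNIV \<Omega> f] assms that by auto
  then show ?thesis
    by (auto simp: holo2_def)
qed

lemma holo2_lincomb:
  assumes "holo2 f \<Omega>" "holo2 g \<Omega>"
  shows "holo2 (\<lambda>z. a * f z + b * g z) \<Omega>"
  unfolding holo2_def
proof
  fix z assume z: "z \<in> \<Omega>"
  obtain L where L: "(f has_derivative L) (at z)" "\<And>c v. L (scaleC2 c v) = c * L v"
    using holo2_has_derivativeE[OF assms(1) z] by blast
  obtain M where M: "(g has_derivative M) (at z)" "\<And>c v. M (scaleC2 c v) = c * M v"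
    using holo2_has_derivativeE[OF assms(2) z] by blast
  have "((\<lambda>z. a * f z + b * g z) has_derivative (\<lambda>v. a * L v + b * M v)) (at z)"
    by (intro derivative_intros L M)
  then show "\<exists>L. ((\<lambda>z. a * f z + b * g z) has_derivative L) (at z) \<and> (\<forall>c v. L (scaleC2 c v) = c * L v)"
    by (rule exI[where x="\<lambda>v. a * L v + b * M v", OF conjI]) (simp add: L M algebra_simps)
qed

lemma holo2_mult:
  assumes "holo2 f \<Omega>" "holo2 g \<Omega>"
  shows "holo2 (\<lambda>z. f z * g z) \<Omega>"
  unfolding holo2_def
proof
  fix z assume z: "z \<in> \<Omega>"
  obtain L where L: "(f has_derivative L) (at z)" "\<And>c v. L (scaleC2 c v) = c * L v"
    using holo2_has_derivativeE[OF assms(1) z] by blast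
  obtain M where M: "(g has_derivative M) (at z)" "\<And>c v. M (scaleC2 c v) = c * M v"
    using holo2_has_derivativeE[OF assms(2) z] by blast
  have "((\<lambda>z. f z * g z) has_derivative (\<lambda>v. f z * M v + L v * g z)) (at z)"
    by (intro has_derivative_mult L M)
  then show "\<exists>L. ((\<lambda>z. f z * g z) has_derivative L) (at z) \<and> (\<forall>c v. L (scaleC2 c v) = c * L v)"
    by (rule exI[where x="\<lambda>v. f z * M v + L v * g z", OF conjI]) (simp add: L M algebra_simps)
qed

lemma bounded_linear_scaleC2: "bounded_linear (\<lambda>c. scaleC2 c v)"
  unfolding scaleC2_def
  by (intro bounded_linear_Pair bounded_linear_mult_left)

lemma norm_scaleC2: "norm (scaleC2 c v) = norm c * norm v"
proof -
  have "sqrt ((norm c * norm (fst v))\<^sup>2 + (norm c * norm (snd v))\<^sup>2)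
      = sqrt ((norm c)\<^sup>2 * ((norm (fst v))\<^sup>2 + (norm (snd v))\<^sup>2))"
    by (simp add: algebra_simps power_mult_distrib)
  then show ?thesis
    by (simp add: scaleC2_def norm_prod_def norm_mult real_sqrt_mult)
qed

text \<open>The bridge to one complex variable: by homogeneity of \<open>L\<close>, the real
  derivative along a complex line, \<open>L (scaleC2 c v)\<close>, is multiplication of
  \<open>c\<close> by \<open>L v\<close>.\<close>

lemma has_field_derivative_line:
  assumes L: "(f has_derivative L) (at (z + scaleC2 \<zeta> v))" "\<And>c v. L (scaleC2 c v) = c * L v"
  shows "((\<lambda>\<zeta>. f (z + scaleC2 \<zeta> v)) has_field_derivative L v) (at \<zeta>)"
proof -
  have "((\<lambda>\<zeta>. z + scaleC2 \<zeta> v) has_derivative (\<lambda>c. 0 + scaleC2 c v)) (at \<zeta>)"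
    by (intro has_derivative_add has_derivative_const
        bounded_linear_imp_has_derivative bounded_linear_scaleC2)
  then have "((\<lambda>\<zeta>. z + scaleC2 \<zeta> v) has_derivative (\<lambda>c. scaleC2 c v)) (at \<zeta>)"
    by simp
  from has_derivative_compose[OF this L(1)] show ?thesis
    by (simp add: L(2) has_field_derivative_def mult_commute_abs)
qed

lemma holo2_line:
  assumes "holo2 f \<Omega>" "\<And>\<zeta>. \<zeta> \<in> S \<Longrightarrow> z + scaleC2 \<zeta> v \<in> \<Omega>"
  shows "(\<lambda>\<zeta>. f (z + scaleC2 \<zeta> v)) holomorphic_on S"
proof -
  have "(\<lambda>\<zeta>. f (z + scaleC2 \<zeta> v)) field_differentiable at \<zeta>" if "\<zeta> \<in> S" for \<zeta>
    using assms(1) assms(2)[OF that]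
    by (rule holo2_has_derivativeE) (metis has_field_derivative_line field_differentiable_def)
  then show ?thesis
    by (simp add: holomorphic_on_def field_differentiable_at_within)
qed

lemma indicator_of_real: "of_real (indicator A x) = (indicator A x :: 'a :: real_algebra_1)"
  by (simp add: indicator_def)

lemma lborel_integral_indicator_ball:
  "(\<integral>w. indicator (ball z r) w \<partial>lborel) = (of_real (measure lborel (ball z r)) :: complex)"
proof -
  have "(\<integral>w. indicator (ball z r) w \<partial>lborel) = (\<integral>w. complex_of_real (indicator (ball z r) w) \<partial>lborel)"
    by (simp add: indicator_of_real)
  also have "\<dots> = of_real (measure lborel (ball z r))"
    by (subst integral_complex_of_real) simp
  finally show ?thesis .
qed

text \<open>Multiplying both coordinates of \<open>w - z\<close> by the same unit scalar preserves
  the ball and the measure. Averaging over these scalars reduces the claim to the one-variable mean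
  value property on complex lines through \<open>z\<close>.\<close>

lemma holo2_ball_mean:
  assumes f: "holo2 f \<Omega>" and sub: "cball z r \<subseteq> \<Omega>"
  shows "integrable lborel (\<lambda>w. indicator (ball z r) w * f w)"
    and "(\<integral>w. indicator (ball z r) w * f w \<partial>lborel)
      = of_real (measure lborel (ball (0::complex \<times> complex) r)) * f z"
proof -
  \<comment> \<open>The integrand is extended by zero to the whole space and then, as
    \<open>H\<close>, translated so that the rotations fix the centre of the ball.\<close>
  define G where "G = (\<lambda>w. indicator (ball z r) w * f w)"
  define H where "H = (\<lambda>w. G (z + w))"
  have c: "continuous_on (cball z r) f"
    using holo2_imp_continuous_on[OF f] sub continuous_on_subset by blast
  have "set_integrable lborel (cball z r) f"
    using borel_integrable_compact[OF compact_cball c] by (simp add: set_integrable_def)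
  then have "set_integrable lborel (ball z r) f"
    by (rule set_integrable_subset) auto
  then show Gi: "integrable lborel (\<lambda>w. indicator (ball z r) w * f w)"
    by (simp add: set_integrable_def scaleR_conv_of_real indicator_of_real)
  then have Gm[measurable]: "G \<in> borel_measurable borel"
    by (simp add: G_def)
  have "integrable (distr lborel borel ((+) z)) G"
    using Gi by (simp add: lborel_distr_plus G_def)
  then have Hi: "integrable lborel H"
    by (subst (asm) integrable_distr_eq) (auto simp: H_def)
  have HG: "(\<integral>w. H w \<partial>lborel) = (\<integral>w. G w \<partial>lborel)"
    by (subst (2) lborel_distr_plus[of z, symmetric]) (simp add: H_def integral_distr)
  define T where "T = (\<lambda>t (w::complex \<times> complex). (ecirc t * fst w, ecirc t * snd w))"
  have T_scale: "T t w = scaleC2 (ecirc t) w" for t w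
    by (simp add: T_def scaleC2_def)
  have av: "(\<integral>t. H (T t w) \<partial>unit_itv) = indicator (ball 0 r) w * f z" for w
  proof (cases "norm w < r")
    case True
    \<comment> \<open>The whole closed unit disc of scalars is admissible, not only its boundary,
      since \<open>norm (scaleC2 \<zeta> w)\<close> is at most \<open>norm w\<close>; the mean value
      property needs holomorphy there.\<close>
    have in_cb: "z + scaleC2 \<zeta> w \<in> \<Omega>" if "\<zeta> \<in> cball 0 1" for \<zeta>
    proof -
      have "norm \<zeta> * norm w \<le> 1 * norm w"
        using that by (intro mult_right_mono) auto
      then show ?thesis
        using True by (intro subsetD[OF sub]) (simp add: dist_norm norm_scaleC2)
    qed
    have hol: "(\<lambda>\<zeta>. f (z + scaleC2 \<zeta> w)) holomorphic_on cball 0 1"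
      using in_cb by (intro holo2_line[OF f]) auto
    have eq: "H (T t w) = f (z + scaleC2 (ecirc t) w)" for t
      using True by (simp add: H_def G_def T_scale dist_norm norm_scaleC2)
    have "continuous_on {0..1} (\<lambda>t. f (z + scaleC2 (ecirc t) w))"
      by (rule continuous_on_compose2[OF holomorphic_on_imp_continuous_on[OF hol]])
         (auto intro!: continuous_intros)
    then show ?thesis
      using circle_mean_value[OF hol] True
      by (simp add: eq integral_unit_itv scaleC2_def zero_prod_def[symmetric])
  next
    case False
    then show ?thesis
      by (simp add: H_def G_def T_scale dist_norm norm_scaleC2)
  qed
  have Tm: "(\<lambda>(t, w). T t w) \<in> borel \<Otimes>\<^sub>M borel \<rightarrow>\<^sub>M borel"
    unfolding T_def borel_prod case_prod_beta
    by (intro borel_measurable_continuous_onI continuous_intros)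
  have "(\<integral>w. H w \<partial>lborel) = (\<integral>w. (\<integral>t. H (T t w) \<partial>unit_itv) \<partial>lborel)"
    by (rule integral_average(2)[symmetric, OF Tm _ Hi]) (simp add: T_def lborel_rotate_C2)
  also have "\<dots> = (\<integral>w. indicator (ball (0::complex \<times> complex) r) w * f z \<partial>lborel)"
    by (simp add: av)
  also have "\<dots> = of_real (measure lborel (ball (0::complex \<times> complex) r)) * f z"
    by (simp only: integral_mult_left_zero lborel_integral_indicator_ball)
  finally show "(\<integral>w. indicator (ball z r) w * f w \<partial>lborel)
      = of_real (measure lborel (ball (0::complex \<times> complex) r)) * f z"
    by (simp add: HG G_def)
qed

section \<open>Point evaluations of square integrable holomorphic functions\<close>

definition L2sq :: "(complex \<times> complex) set \<Rightarrow> (complex \<times> complex \<Rightarrow> complex) \<Rightarrow> real" where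
  "L2sq \<Omega> f = (\<integral>u. (norm (f u))\<^sup>2 \<partial>lebesgue_on \<Omega>)"

lemma Lp2_iff:
  "Lp 2 \<Omega> f \<longleftrightarrow> f \<in> borel_measurable (lebesgue_on \<Omega>) \<and> integrable (lebesgue_on \<Omega>) (\<lambda>u. (norm (f u))\<^sup>2)"
  by (simp add: Lp_def)

text \<open>Projection and norms are stated over \<open>lebesgue_on\<close>, while rotation
  invariance and Fubini are proved for \<open>lborel\<close>. Borel measurability of the extension
  by zero permits the transfer.\<close>

lemma lebesgue_on_integral_borel:
  fixes f :: "'a::euclidean_space \<Rightarrow> 'b::{banach, second_countable_topology}"
  assumes S[measurable]: "S \<in> sets borel" and f: "(\<lambda>w. indicator S w *\<^sub>R f w) \<in> borel_measurable borel"
  shows "integrable (lebesgue_on S) f \<longleftrightarrow> integrable lborel (\<lambda>w. indicator S w *\<^sub>R f w)"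
    and "(\<integral>w. f w \<partial>lebesgue_on S) = (\<integral>w. indicator S w *\<^sub>R f w \<partial>lborel)"
proof -
  have S': "S \<inter> space lebesgue \<in> sets lebesgue"
    by simp
  show "integrable (lebesgue_on S) f \<longleftrightarrow> integrable lborel (\<lambda>w. indicator S w *\<^sub>R f w)"
    using f by (simp add: integrable_restrict_space[OF S'] integrable_completion)
  show "(\<integral>w. f w \<partial>lebesgue_on S) = (\<integral>w. indicator S w *\<^sub>R f w \<partial>lborel)"
    using f by (simp add: integral_restrict_space[OF S'] integral_completion)
qed

lemma borel_measurable_indicator_continuous_on:
  fixes f :: "'a::euclidean_space \<Rightarrow> 'b::{banach, second_countable_topology}"
  assumes "open S" "continuous_on S f"
  shows "(\<lambda>w. indicator S w *\<^sub>R f w) \<in> borel_measurable borel"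
  using assms by (intro borel_measurable_continuous_on_indicator) auto

text \<open>The mean value property is applied to the holomorphic function \<open>f * f\<close>,
  whose absolute value is the integrand of \<open>L2sq\<close>.\<close>

lemma Ap2_evaluation_bound:
  assumes "open \<Omega>" and f: "Ap 2 \<Omega> f" and sub: "cball z r \<subseteq> \<Omega>"
  shows "measure lborel (ball (0::complex \<times> complex) r) * (norm (f z))\<^sup>2 \<le> L2sq \<Omega> f"
proof -
  have h: "holo2 f \<Omega>" and L2: "integrable (lebesgue_on \<Omega>) (\<lambda>u. (norm (f u))\<^sup>2)"
    using f by (auto simp: Ap_def Lp2_iff)
  note mean = holo2_ball_mean[OF holo2_mult[OF h h] sub]
  have bm: "(\<lambda>w. indicator \<Omega> w *\<^sub>R (norm (f w))\<^sup>2) \<in> borel_measurable borel"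
    using holo2_imp_continuous_on[OF h] assms(1)
    by (intro borel_measurable_indicator_continuous_on continuous_intros) auto
  have i2: "integrable lborel (\<lambda>w. indicator \<Omega> w *\<^sub>R (norm (f w))\<^sup>2)"
    using L2 bm assms(1) by (subst (asm) lebesgue_on_integral_borel) auto
  have "measure lborel (ball (0::complex \<times> complex) r) * (norm (f z))\<^sup>2
      = norm (\<integral>w. indicator (ball z r) w * (f w * f w) \<partial>lborel)"
    unfolding mean by (simp add: norm_mult power2_eq_square)
  also have "\<dots> \<le> (\<integral>w. indicator \<Omega> w *\<^sub>R (norm (f w))\<^sup>2 \<partial>lborel)"
  proof (rule Bochner_Integration.integral_norm_bound_integral[OF mean(1) i2])
    fix w
    show "norm (indicator (ball z r) w * (f w * f w)) \<le> indicator \<Omega> w *\<^sub>R (norm (f w))\<^sup>2"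
      using sub[THEN subsetD, of w] by (auto simp: indicator_def norm_mult power2_eq_square)
  qed
  also have "\<dots> = L2sq \<Omega> f"
    using bm assms(1) unfolding L2sq_def by (subst lebesgue_on_integral_borel) auto
  finally show ?thesis .
qed

section \<open>Locally uniform limits and the inner product of \<open>L\<^sup>2\<close>\<close>

text \<open>The one-variable Cauchy inequality for the restriction of \<open>f\<close> to the
  complex line through \<open>x\<close> in direction \<open>v\<close>, whose derivative at 0 is
  \<open>L v\<close>.\<close>

lemma holo2_deriv_Cauchy_estimate:
  assumes f: "holo2 f (ball z r)" and r: "r > 0"
    and x: "x \<in> ball z (r/2)" and L: "(f has_derivative L) (at x)" "\<And>c v. L (scaleC2 c v) = c * L v"
    and B: "\<And>y. y \<in> ball z r \<Longrightarrow> norm (f y) \<le> B"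
  shows "norm (L v) \<le> 4 * B / r * norm v"
proof (cases "v = 0")
  case True
  then show ?thesis
    using L(1) by (simp add: has_derivative_bounded_linear linear_0 bounded_linear.linear)
next
  case False
  \<comment> \<open>With this radius the points \<open>x + scaleC2 \<zeta> v\<close> stay within
    \<open>r / 4\<close> of \<open>x\<close>, hence inside \<open>ball z r\<close>; it also produces
    the constant 4.\<close>
  define \<rho> where "\<rho> = r / (4 * norm v)"
  have \<rho>: "\<rho> > 0" "\<rho> * norm v < r / 2"
    using False r by (auto simp: \<rho>_def)
  have inb: "x + scaleC2 \<zeta> v \<in> ball z r" if "\<zeta> \<in> cball 0 \<rho>" for \<zeta>
  proof -
    have "norm \<zeta> * norm v \<le> \<rho> * norm v"
      using that by (intro mult_right_mono) auto
    then have "norm (scaleC2 \<zeta> v) < r / 2"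
      using \<rho> by (simp add: norm_scaleC2)
    moreover have "dist z (x + scaleC2 \<zeta> v) \<le> dist z x + norm (scaleC2 \<zeta> v)"
      by (metis add_diff_cancel_left' dist_commute dist_norm dist_triangle)
    ultimately show ?thesis
      using x by simp
  qed
  have hol: "(\<lambda>\<zeta>. f (x + scaleC2 \<zeta> v)) holomorphic_on cball 0 \<rho>"
    using inb by (intro holo2_line[OF f]) auto
  have z0: "x + scaleC2 0 v = x"
    by (simp add: scaleC2_def zero_prod_def[symmetric])
  have "deriv (\<lambda>\<zeta>. f (x + scaleC2 \<zeta> v)) 0 = L v"
    using L by (intro DERIV_imp_deriv has_field_derivative_line) (auto simp: z0)
  moreover have "norm ((deriv ^^ 1) (\<lambda>\<zeta>. f (x + scaleC2 \<zeta> v)) 0) \<le> fact 1 * B / \<rho> ^ 1"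
    by (rule Cauchy_inequality)
       (use hol inb B \<rho> in \<open>auto intro: holomorphic_on_subset holomorphic_on_imp_continuous_on\<close>)
  ultimately have "norm (L v) \<le> B / \<rho>"
    by simp
  then show ?thesis
    by (simp add: \<rho>_def mult_ac)
qed

text \<open>Weierstrass' theorem in two variables: by the Cauchy estimate the derivatives converge
  uniformly on a smaller ball, so their limit is the derivative of the limit, and complex
  homogeneity passes to the limit.\<close>

lemma holo2_uniform_limit:
  fixes f :: "nat \<Rightarrow> complex \<times> complex \<Rightarrow> complex"
  assumes \<Omega>: "open \<Omega>" and f: "\<And>n. holo2 (f n) \<Omega>"
    and cauchy: "\<And>z. z \<in> \<Omega> \<Longrightarrow> \<exists>r>0. \<forall>e>0. \<exists>N. \<forall>m\<ge>N. \<forall>n\<ge>N. \<forall>x\<in>ball z r. norm (f m x - f n x) \<le> e"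
    and lim: "\<And>z. z \<in> \<Omega> \<Longrightarrow> (\<lambda>n. f n z) \<longlonglongrightarrow> g z"
  shows "holo2 g \<Omega>"
  unfolding holo2_def
proof
  fix z assume z: "z \<in> \<Omega>"
  obtain L where L: "\<And>n x. x \<in> \<Omega> \<Longrightarrow> (f n has_derivative L n x) (at x)"
    "\<And>n x c v. x \<in> \<Omega> \<Longrightarrow> L n x (scaleC2 c v) = c * L n x v"
    using f unfolding holo2_def by metis
  obtain r1 where r1: "r1 > 0" "ball z r1 \<subseteq> \<Omega>"
    using \<Omega> z openE by blast
  obtain r2 where r2: "r2 > 0" "\<And>e. e > 0 \<Longrightarrow> \<exists>N. \<forall>m\<ge>N. \<forall>n\<ge>N. \<forall>x\<in>ball z r2. norm (f m x - f n x) \<le> e"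
    using cauchy[OF z] by blast
  define r where "r = min r1 r2"
  have r: "r > 0" "ball z r \<subseteq> \<Omega>"
    using r1 r2 by (auto simp: r_def)
  have cau: "\<exists>N. \<forall>m\<ge>N. \<forall>n\<ge>N. \<forall>x\<in>ball z r. norm (f m x - f n x) \<le> e" if "e > 0" for e
    using r2(2)[OF that] subset_ball[of r r2 z] unfolding r_def
    by (meson min.cobounded2 subsetD)
  define S where "S = ball z (r/2)"
  have S: "S \<subseteq> ball z r" "S \<subseteq> \<Omega>" "z \<in> S" "open S" "convex S"
    using r by (auto simp: S_def)
  \<comment> \<open>The derivative estimate is applied to \<open>f m - f n\<close>; the tolerance
    \<open>e * r / 4\<close> for the functions offsets the factor \<open>4 / r\<close>.\<close>
  have est: "\<exists>N. \<forall>m\<ge>N. \<forall>n\<ge>N. \<forall>x\<in>S. \<forall>v. norm (L m x v - L n x v) \<le> e * norm v" if "e > 0" for e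
  proof -
    have "e * r / 4 > 0"
      using that r by simp
    from cau[OF this] obtain N where N: "\<And>m n x. m \<ge> N \<Longrightarrow> n \<ge> N \<Longrightarrow> x \<in> ball z r \<Longrightarrow> norm (f m x - f n x) \<le> e * r / 4"
      by blast
    have "norm (L m x v - L n x v) \<le> e * norm v" if mn: "m \<ge> N" "n \<ge> N" and x: "x \<in> S" for m n x v
    proof -
      have "holo2 (\<lambda>x. 1 * f m x + (-1) * f n x) (ball z r)"
        by (intro holo2_lincomb holo2_subset[OF f r(2)])
      then have h: "holo2 (\<lambda>x. f m x - f n x) (ball z r)"
        by simp
      have x': "x \<in> \<Omega>"
        using x S(2) by blast
      have d: "((\<lambda>x. f m x - f n x) has_derivative (\<lambda>v. L m x v - L n x v)) (at x)"
        by (intro derivative_intros L x')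
      have "norm (L m x v - L n x v) \<le> 4 * (e * r / 4) / r * norm v"
        by (rule holo2_deriv_Cauchy_estimate[OF h r(1) _ d])
           (use x x' N mn L(2) in \<open>simp_all add: S_def algebra_simps\<close>)
      then show ?thesis
        using r by simp
    qed
    then show ?thesis
      by blast
  qed
  define L' where "L' x v = lim (\<lambda>n. L n x v)" for x v
  have L': "(\<lambda>n. L n x v) \<longlonglongrightarrow> L' x v" if x: "x \<in> S" for x v
  proof -
    have "Cauchy (\<lambda>n. L n x v)"
    proof (rule CauchyI)
      fix e :: real assume e: "e > 0"
      \<comment> \<open>Adding 1 keeps the denominator positive when \<open>v = 0\<close> and makes
        the final inequality strict.\<close>
      then have "e / (norm v + 1) > 0"
        by (simp add: add_nonneg_pos)
      from est[OF this] obtain N where N: "\<And>m n. m \<ge> N \<Longrightarrow> n \<ge> N \<Longrightarrow> norm (L m x v - L n x v) \<le> e / (norm v + 1) * norm v"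
        using x by blast
      have "e / (norm v + 1) * norm v < e"
      proof -
        have p: "norm v + 1 > 0"
          by (simp add: add_nonneg_pos)
        have "e * norm v < e * (norm v + 1)"
          using e by simp
        then show ?thesis
          using p by (simp only: pos_divide_less_eq[OF p] times_divide_eq_left)
      qed
      with N show "\<exists>N. \<forall>m\<ge>N. \<forall>n\<ge>N. norm (L m x v - L n x v) < e"
        by (meson le_less_trans)
    qed
    then show ?thesis
      unfolding L'_def by (simp add: Cauchy_convergent_iff convergent_LIMSEQ_iff)
  qed
  have "\<exists>h. \<forall>x\<in>S. (\<lambda>n. f n x) \<longlonglongrightarrow> h x \<and> (h has_derivative L' x) (at x within S)"
  proof (rule has_derivative_sequence[OF S(5)])
    show "(f n has_derivative L n x) (at x within S)" if "x \<in> S" for n x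
      using L(1) that S(2) has_derivative_at_withinI by blast
    show "\<forall>\<^sub>F n in sequentially. \<forall>x\<in>S. \<forall>h. norm (L n x h - L' x h) \<le> e * norm h" if "e > 0" for e
    proof -
      obtain N where N: "\<And>m n x v. m \<ge> N \<Longrightarrow> n \<ge> N \<Longrightarrow> x \<in> S \<Longrightarrow> norm (L m x v - L n x v) \<le> e * norm v"
        using est[OF \<open>e > 0\<close>] by blast
      have "norm (L n x v - L' x v) \<le> e * norm v" if "n \<ge> N" "x \<in> S" for n x v
      proof (rule LIMSEQ_le_const2)
        show "(\<lambda>m. norm (L n x v - L m x v)) \<longlonglongrightarrow> norm (L n x v - L' x v)"
          by (intro tendsto_intros L' that)
        show "\<exists>M. \<forall>m\<ge>M. norm (L n x v - L m x v) \<le> e * norm v"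
          using N that by blast
      qed
      then show ?thesis
        unfolding eventually_sequentially by blast
    qed
  qed (use S(3) lim[OF z] in auto)
  then obtain h where h: "\<And>x. x \<in> S \<Longrightarrow> (\<lambda>n. f n x) \<longlonglongrightarrow> h x"
    "\<And>x. x \<in> S \<Longrightarrow> (h has_derivative L' x) (at x within S)"
    by blast
  have hg: "h x = g x" if "x \<in> S" for x
    using h(1)[OF that] lim S(2) that LIMSEQ_unique by blast
  have "(h has_derivative L' z) (at z)"
    using h(2)[OF S(3)] at_within_open[OF S(3,4)] by simp
  then have "(g has_derivative L' z) (at z)"
    by (rule has_derivative_transform_within_open[OF _ S(4) S(3)]) (simp add: hg)
  moreover have "L' z (scaleC2 c v) = c * L' z v" for c v
  proof (rule LIMSEQ_unique)
    show "(\<lambda>n. L n z (scaleC2 c v)) \<longlonglongrightarrow> L' z (scaleC2 c v)"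
      by (rule L'[OF S(3)])
    show "(\<lambda>n. L n z (scaleC2 c v)) \<longlonglongrightarrow> c * L' z v"
      unfolding L(2)[OF z] by (intro tendsto_intros L' S)
  qed
  ultimately show "\<exists>L. (g has_derivative L) (at z) \<and> (\<forall>c v. L (scaleC2 c v) = c * L v)"
    by blast
qed

section \<open>The inner product and its elementary identities\<close>

definition L2ip :: "(complex \<times> complex) set \<Rightarrow> (complex \<times> complex \<Rightarrow> complex) \<Rightarrow> (complex \<times> complex \<Rightarrow> complex) \<Rightarrow> complex" where
  "L2ip \<Omega> f g = (\<integral>u. f u * cnj (g u) \<partial>lebesgue_on \<Omega>)"

lemma borel_measurable_cnj [measurable (raw)]:
  "f \<in> borel_measurable M \<Longrightarrow> (\<lambda>x. cnj (f x)) \<in> borel_measurable M"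
  by (rule measurable_compose[where N=borel])
     (auto intro!: borel_measurable_continuous_onI continuous_intros)

lemma norm_mult_le_L2: "norm (a * cnj b) \<le> (norm a)\<^sup>2 + (norm b)\<^sup>2" for a b :: complex
proof -
  have "0 \<le> (norm a - norm b)\<^sup>2"
    by simp
  then have "2 * (norm a * norm b) \<le> (norm a)\<^sup>2 + (norm b)\<^sup>2"
    by (simp add: power2_diff)
  moreover have "0 \<le> norm a * norm b"
    by simp
  ultimately have "norm a * norm b \<le> (norm a)\<^sup>2 + (norm b)\<^sup>2"
    by linarith
  then show ?thesis
    by (simp add: norm_mult)
qed

lemma Lp2_mult_integrable:
  assumes "Lp 2 \<Omega> f" "Lp 2 \<Omega> g"
  shows "integrable (lebesgue_on \<Omega>) (\<lambda>u. f u * cnj (g u))"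
proof (rule Bochner_Integration.integrable_bound)
  show "integrable (lebesgue_on \<Omega>) (\<lambda>u. (norm (f u))\<^sup>2 + (norm (g u))\<^sup>2)"
    using assms by (simp add: Lp2_iff)
  have [measurable]: "f \<in> borel_measurable (lebesgue_on \<Omega>)" "g \<in> borel_measurable (lebesgue_on \<Omega>)"
    using assms by (auto simp: Lp2_iff)
  show "(\<lambda>u. f u * cnj (g u)) \<in> borel_measurable (lebesgue_on \<Omega>)"
    by measurable
  show "AE u in lebesgue_on \<Omega>. norm (f u * cnj (g u)) \<le> norm ((norm (f u))\<^sup>2 + (norm (g u))\<^sup>2)"
    using norm_mult_le_L2 by (intro AE_I2) (simp add: abs_of_nonneg)
qed

lemma norm_lincomb_sq:
  "(norm (a * x + b * y))\<^sup>2 = (norm a)\<^sup>2 * (norm x)\<^sup>2 + 2 * Re (a * cnj b * (x * cnj y)) + (norm b)\<^sup>2 * (norm y)\<^sup>2"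
  for a b x y :: complex
  unfolding cmod_power2 by (simp add: algebra_simps power2_eq_square)

text \<open>The expansion of the squared norm with general coefficients serves Cauchy-Schwarz, the
  parallelogram argument and the variation of the minimised functional.\<close>

lemma Lp2_lincomb:
  assumes "Lp 2 \<Omega> f" "Lp 2 \<Omega> g"
  shows "Lp 2 \<Omega> (\<lambda>u. a * f u + b * g u)"
    and "L2sq \<Omega> (\<lambda>u. a * f u + b * g u)
      = (norm a)\<^sup>2 * L2sq \<Omega> f + 2 * Re (a * cnj b * L2ip \<Omega> f g) + (norm b)\<^sup>2 * L2sq \<Omega> g"
proof -
  have i: "integrable (lebesgue_on \<Omega>) (\<lambda>u. (norm (f u))\<^sup>2)" "integrable (lebesgue_on \<Omega>) (\<lambda>u. (norm (g u))\<^sup>2)"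
    "integrable (lebesgue_on \<Omega>) (\<lambda>u. f u * cnj (g u))"
    using assms Lp2_mult_integrable[OF assms] by (auto simp: Lp2_iff)
  have [measurable]: "f \<in> borel_measurable (lebesgue_on \<Omega>)" "g \<in> borel_measurable (lebesgue_on \<Omega>)"
    using assms by (auto simp: Lp2_iff)
  have eq: "(norm (a * f u + b * g u))\<^sup>2 = (norm a)\<^sup>2 * (norm (f u))\<^sup>2 + 2 * Re (a * cnj b * (f u * cnj (g u)))
      + (norm b)\<^sup>2 * (norm (g u))\<^sup>2" for u
    by (rule norm_lincomb_sq)
  show "Lp 2 \<Omega> (\<lambda>u. a * f u + b * g u)"
    unfolding Lp2_iff eq using i
    by (intro conjI Bochner_Integration.integrable_add integrable_mult_right integrable_Re) auto
  define R where "R u = Re (a * cnj b * (f u * cnj (g u)))" for u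
  have R: "integrable (lebesgue_on \<Omega>) R"
    unfolding R_def using i(3) by (intro integrable_Re integrable_mult_right)
  have "L2sq \<Omega> (\<lambda>u. a * f u + b * g u) = (norm a)\<^sup>2 * L2sq \<Omega> f
      + 2 * (\<integral>u. R u \<partial>lebesgue_on \<Omega>) + (norm b)\<^sup>2 * L2sq \<Omega> g"
    unfolding L2sq_def eq R_def[symmetric] using i R by simp
  also have "(\<integral>u. R u \<partial>lebesgue_on \<Omega>) = Re (a * cnj b * L2ip \<Omega> f g)"
    using i(3) unfolding L2ip_def R_def
    by (subst integral_Re) (simp_all del: times_complex.sel)
  finally show "L2sq \<Omega> (\<lambda>u. a * f u + b * g u)
      = (norm a)\<^sup>2 * L2sq \<Omega> f + 2 * Re (a * cnj b * L2ip \<Omega> f g) + (norm b)\<^sup>2 * L2sq \<Omega> g" .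
qed

lemma L2ip_lincomb_left:
  assumes "Lp 2 \<Omega> f" "Lp 2 \<Omega> g" "Lp 2 \<Omega> h"
  shows "L2ip \<Omega> (\<lambda>u. a * f u + b * g u) h = a * L2ip \<Omega> f h + b * L2ip \<Omega> g h"
proof -
  have "L2ip \<Omega> (\<lambda>u. a * f u + b * g u) h
      = (\<integral>u. a * (f u * cnj (h u)) + b * (g u * cnj (h u)) \<partial>lebesgue_on \<Omega>)"
    by (simp add: L2ip_def algebra_simps)
  also have "\<dots> = a * L2ip \<Omega> f h + b * L2ip \<Omega> g h"
    using Lp2_mult_integrable[OF assms(1,3)] Lp2_mult_integrable[OF assms(2,3)]
    by (simp add: L2ip_def)
  finally show ?thesis .
qed

lemma L2ip_commute: "L2ip \<Omega> g f = cnj (L2ip \<Omega> f g)"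
  by (simp add: L2ip_def mult.commute flip: Bochner_Integration.integral_cnj)

lemma L2sq_nonneg [simp]: "L2sq \<Omega> f \<ge> 0"
  by (simp add: L2sq_def)

lemma L2ip_self: "Lp 2 \<Omega> f \<Longrightarrow> L2ip \<Omega> f f = of_real (L2sq \<Omega> f)"
  by (simp add: L2ip_def L2sq_def flip: complex_norm_square integral_complex_of_real)

lemma L2_Cauchy_Schwarz:
  assumes f: "Lp 2 \<Omega> f" and g: "Lp 2 \<Omega> g"
  shows "(norm (L2ip \<Omega> f g))\<^sup>2 \<le> L2sq \<Omega> f * L2sq \<Omega> g"
proof -
  define c F G where "c = L2ip \<Omega> f g" and "F = L2sq \<Omega> f" and "G = L2sq \<Omega> g"
  have nn: "F \<ge> 0" "G \<ge> 0"
    by (auto simp: F_def G_def)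
  \<comment> \<open>This is the squared norm of \<open>f + t c g\<close>. The factor
    \<open>c\<close> makes the cross term real for real \<open>t\<close>, leaving a quadratic in one
    real variable.\<close>
  have key: "0 \<le> F + 2 * t * (norm c)\<^sup>2 + t\<^sup>2 * (norm c)\<^sup>2 * G" for t :: real
  proof -
    have "0 \<le> L2sq \<Omega> (\<lambda>u. 1 * f u + of_real t * c * g u)"
      by simp
    also have "\<dots> = F + 2 * Re (cnj (of_real t * c) * c) + (norm (of_real t * c))\<^sup>2 * G"
      by (subst Lp2_lincomb(2)[OF f g]) (simp add: F_def G_def c_def)
    also have "Re (cnj (of_real t * c) * c) = t * (norm c)\<^sup>2"
      unfolding cmod_power2 by (simp add: power2_eq_square algebra_simps)
    finally show ?thesis
      by (simp add: norm_mult power_mult_distrib mult.assoc)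
  qed
  show ?thesis
  proof (cases "c = 0")
    case False
    then have cp: "(norm c)\<^sup>2 > 0"
      by simp
    show ?thesis
    proof (cases "G = 0")
      case True
      \<comment> \<open>For \<open>G = 0\<close> the quadratic is affine in \<open>t\<close>; at
        this \<open>t\<close> it would equal -1.\<close>
      have "2 * (- (F + 1) / (2 * (norm c)\<^sup>2)) * (norm c)\<^sup>2 = - (F + 1)"
        using cp by (simp add: field_simps)
      then show ?thesis
        using key[of "- (F + 1) / (2 * (norm c)\<^sup>2)"] True nn by simp
    next
      case False
      then have G: "G > 0"
        using nn by simp
      \<comment> \<open>The minimum of the quadratic is attained at
        \<open>t = - 1 / G\<close>.\<close>
      have "0 \<le> F + 2 * (- 1 / G) * (norm c)\<^sup>2 + (- 1 / G)\<^sup>2 * (norm c)\<^sup>2 * G"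
        by (rule key)
      also have "\<dots> = F - (norm c)\<^sup>2 / G"
        using G by (simp add: field_simps power2_eq_square)
      finally show ?thesis
        using G by (simp add: c_def F_def G_def field_simps)
    qed
  qed (simp add: c_def[symmetric])
qed

lemma Ap2_lincomb:
  assumes "Ap 2 \<Omega> f" "Ap 2 \<Omega> g"
  shows "Ap 2 \<Omega> (\<lambda>u. a * f u + b * g u)"
  using assms by (auto simp: Ap_def intro: holo2_lincomb Lp2_lincomb)

section \<open>The Bergman projection on \<open>L\<^sup>2\<close>\<close>

lemma Ap2_I: "holo2 f \<Omega> \<Longrightarrow> Lp 2 \<Omega> f \<Longrightarrow> Ap 2 \<Omega> f"
  by (simp add: Ap_def)

lemma Ap2_Lp: "Ap 2 \<Omega> f \<Longrightarrow> Lp 2 \<Omega> f"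
  by (simp add: Ap_def)

lemma Ap2_diff:
  assumes "Ap 2 \<Omega> f" "Ap 2 \<Omega> g"
  shows "Ap 2 \<Omega> (\<lambda>u. f u - g u)"
  using Ap2_lincomb[OF assms, of 1 "-1"] by simp

lemma Ap2_zero: "Ap 2 \<Omega> (\<lambda>u. 0)"
  by (auto simp: Ap_def Lp2_iff holo2_def intro!: exI[where x="\<lambda>_. 0"])

lemma Lp_cong:
  assumes "\<And>u. u \<in> \<Omega> \<Longrightarrow> f u = g u"
  shows "Lp p \<Omega> f \<longleftrightarrow> Lp p \<Omega> g"
proof -
  have s: "f u = g u" if "u \<in> space (lebesgue_on \<Omega>)" for u
    using that assms by (simp add: space_restrict_space)
  have "f \<in> borel_measurable (lebesgue_on \<Omega>) \<longleftrightarrow> g \<in> borel_measurable (lebesgue_on \<Omega>)"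
    by (rule measurable_cong) (rule s)
  moreover have "integrable (lebesgue_on \<Omega>) (\<lambda>u. norm (f u) powr p) \<longleftrightarrow> integrable (lebesgue_on \<Omega>) (\<lambda>u. norm (g u) powr p)"
    by (rule Bochner_Integration.integrable_cong[OF refl]) (simp only: s)
  ultimately show ?thesis
    by (simp add: Lp_def)
qed

lemma Ap_cong:
  assumes "open \<Omega>" "\<And>u. u \<in> \<Omega> \<Longrightarrow> f u = g u"
  shows "Ap p \<Omega> f \<longleftrightarrow> Ap p \<Omega> g"
  unfolding Ap_def using holo2_cong[OF assms] Lp_cong[OF assms(2)] by simp

text \<open>Every point of the half ball is the centre of a closed ball of the same radius
  \<open>R / 2\<close> inside \<open>cball z R\<close>, so one constant serves all of them.\<close>

lemma Ap2_locally_bounded: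
  assumes "open \<Omega>" "z \<in> \<Omega>"
  obtains r C where "r > 0" "C \<ge> 0" "ball z r \<subseteq> \<Omega>"
    "\<And>f y. Ap 2 \<Omega> f \<Longrightarrow> y \<in> ball z r \<Longrightarrow> (norm (f y))\<^sup>2 \<le> C * L2sq \<Omega> f"
proof -
  obtain R where R: "R > 0" "cball z R \<subseteq> \<Omega>"
    using assms open_contains_cball by blast
  define V where "V = measure lborel (ball (0::complex \<times> complex) (R/2))"
  have V: "V > 0"
    using R by (simp add: V_def content_ball_pos)
  show ?thesis
  proof
    show "R / 2 > 0" "1 / V \<ge> 0" "ball z (R/2) \<subseteq> \<Omega>"
      using R V by (auto simp: subset_iff)
    fix f y assume f: "Ap 2 \<Omega> f" and y: "y \<in> ball z (R/2)"
    have "cball y (R/2) \<subseteq> cball z R"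
      using y R by (intro cball_subset_cball_iff[THEN iffD2]) (auto simp: dist_commute)
    then have "V * (norm (f y))\<^sup>2 \<le> L2sq \<Omega> f"
      unfolding V_def using R by (intro Ap2_evaluation_bound assms f) auto
    then show "(norm (f y))\<^sup>2 \<le> 1 / V * L2sq \<Omega> f"
      using V by (simp add: field_simps)
  qed
qed

text \<open>Norm zero gives vanishing at every point, not just almost everywhere, because
  evaluations are controlled by the norm. Uniqueness of the kernel rests on this.\<close>

lemma Ap2_eq_zero:
  assumes "open \<Omega>" "Ap 2 \<Omega> f" "L2sq \<Omega> f = 0" "z \<in> \<Omega>"
  shows "f z = 0"
proof -
  obtain r C where r: "r > 0" "\<And>f y. Ap 2 \<Omega> f \<Longrightarrow> y \<in> ball z r \<Longrightarrow> (norm (f y))\<^sup>2 \<le> C * L2sq \<Omega> f"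
    using Ap2_locally_bounded[OF assms(1,4)] by metis
  from r(2)[OF assms(2), of z] r(1) assms(3) show ?thesis
    by simp
qed

section \<open>Completeness and Riesz representation\<close>

text \<open>Evaluation bounds turn a Cauchy sequence in norm into a locally uniformly Cauchy one, so
  the pointwise limit is holomorphic. Fatou's lemma then shows that the same limit is attained in
  norm.\<close>

lemma Ap2_complete:
  fixes f :: "nat \<Rightarrow> complex \<times> complex \<Rightarrow> complex"
  assumes \<Omega>: "open \<Omega>" and f: "\<And>n. Ap 2 \<Omega> (f n)"
    and cauchy: "\<And>e. e > 0 \<Longrightarrow> \<exists>N. \<forall>m\<ge>N. \<forall>n\<ge>N. L2sq \<Omega> (\<lambda>u. f m u - f n u) \<le> e"
  obtains g where "Ap 2 \<Omega> g" "(\<lambda>n. L2sq \<Omega> (\<lambda>u. f n u - g u)) \<longlonglongrightarrow> 0"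
proof -
  define g where "g = (\<lambda>z. lim (\<lambda>n. f n z))"
  have loc: "\<exists>r>0. \<forall>e>0. \<exists>N. \<forall>m\<ge>N. \<forall>n\<ge>N. \<forall>x\<in>ball z r. norm (f m x - f n x) \<le> e" if z: "z \<in> \<Omega>" for z
  proof -
    obtain r C where r: "r > 0" "C \<ge> 0" "\<And>f y. Ap 2 \<Omega> f \<Longrightarrow> y \<in> ball z r \<Longrightarrow> (norm (f y))\<^sup>2 \<le> C * L2sq \<Omega> f"
      using Ap2_locally_bounded[OF \<Omega> z] by metis
    have "\<exists>N. \<forall>m\<ge>N. \<forall>n\<ge>N. \<forall>x\<in>ball z r. norm (f m x - f n x) \<le> e" if e: "e > 0" for e
    proof -
      \<comment> \<open>The constant \<open>C\<close> may be 0, hence the denominator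
        \<open>C + 1\<close>.\<close>
      have "e\<^sup>2 / (C + 1) > 0"
        using e r by simp
      from cauchy[OF this] obtain N where
        N: "\<And>m n. m \<ge> N \<Longrightarrow> n \<ge> N \<Longrightarrow> L2sq \<Omega> (\<lambda>u. f m u - f n u) \<le> e\<^sup>2 / (C + 1)"
        by blast
      have "norm (f m x - f n x) \<le> e" if "m \<ge> N" "n \<ge> N" "x \<in> ball z r" for m n x
      proof -
        have "(norm (f m x - f n x))\<^sup>2 \<le> C * L2sq \<Omega> (\<lambda>u. f m u - f n u)"
          by (rule r(3)[OF Ap2_diff[OF f f] that(3)])
        also have "\<dots> \<le> C * (e\<^sup>2 / (C + 1))"
          using N[OF that(1,2)] r(2) by (rule mult_left_mono)
        also have "\<dots> = e\<^sup>2 * (C / (C + 1))"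
          by simp
        also have "\<dots> \<le> e\<^sup>2 * 1"
          using r(2) by (intro mult_left_mono) auto
        finally have "(norm (f m x - f n x))\<^sup>2 \<le> e\<^sup>2"
          by simp
        then show ?thesis
          using less_imp_le[OF e] by (rule power2_le_imp_le)
      qed
      then show ?thesis
        by blast
    qed
    then show ?thesis
      using r(1) by blast
  qed
  have lim: "(\<lambda>n. f n z) \<longlonglongrightarrow> g z" if z: "z \<in> \<Omega>" for z
  proof -
    have "Cauchy (\<lambda>n. f n z)"
    proof (rule CauchyI)
      fix e :: real assume e: "e > 0"
      then have e2: "e / 2 > 0" "e / 2 < e" by simp_all
      obtain r where r: "r > 0" "\<And>e. e > 0 \<Longrightarrow> \<exists>N. \<forall>m\<ge>N. \<forall>n\<ge>N. \<forall>x\<in>ball z r. norm (f m x - f n x) \<le> e"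
        using loc[OF z] by blast
      have "z \<in> ball z r"
        using r(1) by simp
      with r(2)[OF e2(1)] show "\<exists>N. \<forall>m\<ge>N. \<forall>n\<ge>N. norm (f m z - f n z) < e"
        using e2(2) by (meson le_less_trans)
    qed
    then show ?thesis
      unfolding g_def by (simp add: Cauchy_convergent_iff convergent_LIMSEQ_iff)
  qed
  have holg: "holo2 g \<Omega>"
  proof (rule holo2_uniform_limit[OF \<Omega> _ loc lim])
    show "holo2 (f n) \<Omega>" for n
      using f[of n] by (simp add: Ap_def)
  qed
  let ?M = "lebesgue_on \<Omega>"
  have fm[measurable]: "f n \<in> borel_measurable ?M" for n
    using f by (simp add: Ap_def Lp_def)
  have gm[measurable]: "g \<in> borel_measurable ?M"
    using holo2_imp_continuous_on[OF holg] \<Omega>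
    by (intro continuous_imp_measurable_on_sets_lebesgue) auto
  have nn: "(\<integral>\<^sup>+u. ennreal ((norm (f m u - f n u))\<^sup>2) \<partial>?M) = ennreal (L2sq \<Omega> (\<lambda>u. f m u - f n u))" for m n
    using Ap2_diff[OF f f, of m n] unfolding L2sq_def Ap_def Lp2_iff
    by (intro nn_integral_eq_integral) auto
  \<comment> \<open>Fatou's lemma in \<open>n\<close> with \<open>m\<close> fixed; no integrability
    of \<open>g\<close> is known yet, so the estimate is made for nonnegative integrals.\<close>
  have bound: "(\<integral>\<^sup>+u. ennreal ((norm (f m u - g u))\<^sup>2) \<partial>?M) \<le> ennreal e"
    if N: "\<And>n. n \<ge> N \<Longrightarrow> L2sq \<Omega> (\<lambda>u. f m u - f n u) \<le> e" for m N e
  proof -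
    have "(\<integral>\<^sup>+u. ennreal ((norm (f m u - g u))\<^sup>2) \<partial>?M)
        = (\<integral>\<^sup>+u. liminf (\<lambda>n. ennreal ((norm (f m u - f n u))\<^sup>2)) \<partial>?M)"
    proof (rule nn_integral_cong)
      fix u assume "u \<in> space ?M"
      then have "(\<lambda>n. f n u) \<longlonglongrightarrow> g u"
        by (intro lim) (simp add: space_restrict_space)
      then have "(\<lambda>n. ennreal ((norm (f m u - f n u))\<^sup>2)) \<longlonglongrightarrow> ennreal ((norm (f m u - g u))\<^sup>2)"
        by (intro tendsto_intros)
      then show "ennreal ((norm (f m u - g u))\<^sup>2) = liminf (\<lambda>n. ennreal ((norm (f m u - f n u))\<^sup>2))"
        by (rule lim_imp_Liminf[OF trivial_limit_sequentially, symmetric])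
    qed
    also have "\<dots> \<le> liminf (\<lambda>n. \<integral>\<^sup>+u. ennreal ((norm (f m u - f n u))\<^sup>2) \<partial>?M)"
      by (rule nn_integral_liminf) measurable
    also have "\<dots> \<le> limsup (\<lambda>n. \<integral>\<^sup>+u. ennreal ((norm (f m u - f n u))\<^sup>2) \<partial>?M)"
      by (simp add: Liminf_le_Limsup)
    also have "\<dots> \<le> ennreal e"
      using N by (intro Limsup_bounded) (auto simp: nn eventually_sequentially intro!: ennreal_leI)
    finally show ?thesis .
  qed
  have diff: "Lp 2 \<Omega> (\<lambda>u. f m u - g u) \<and> L2sq \<Omega> (\<lambda>u. f m u - g u) \<le> e"
    if N: "\<And>n. n \<ge> N \<Longrightarrow> L2sq \<Omega> (\<lambda>u. f m u - f n u) \<le> e" and e: "e \<ge> 0" for m N e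
  proof -
    note b = bound[OF N]
    have I: "integrable ?M (\<lambda>u. (norm (f m u - g u))\<^sup>2)"
      unfolding integrable_iff_bounded using le_less_trans[OF b ennreal_less_top] by (auto simp: top.not_eq_extremum)
    have "ennreal (L2sq \<Omega> (\<lambda>u. f m u - g u)) = (\<integral>\<^sup>+u. ennreal ((norm (f m u - g u))\<^sup>2) \<partial>?M)"
      unfolding L2sq_def using I by (intro nn_integral_eq_integral[symmetric]) auto
    with b have "ennreal (L2sq \<Omega> (\<lambda>u. f m u - g u)) \<le> ennreal e"
      by simp
    then have "L2sq \<Omega> (\<lambda>u. f m u - g u) \<le> e"
      using e by (simp add: ennreal_le_iff)
    with I show ?thesis
      by (simp add: Lp2_iff)
  qed
  obtain N1 where N1: "\<And>m n. m \<ge> N1 \<Longrightarrow> n \<ge> N1 \<Longrightarrow> L2sq \<Omega> (\<lambda>u. f m u - f n u) \<le> 1"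
    using cauchy[of 1] by auto
  \<comment> \<open>One difference in the space suffices: \<open>g\<close> is \<open>f N1\<close>
    minus this difference.\<close>
  have "Lp 2 \<Omega> (\<lambda>u. f N1 u - g u)"
    using diff[of N1 N1 1] N1 by simp
  from Lp2_lincomb(1)[OF Ap2_Lp[OF f, of N1] this, of 1 "-1"] have "Lp 2 \<Omega> g"
    by simp
  with holg have "Ap 2 \<Omega> g"
    by (rule Ap2_I)
  moreover have "(\<lambda>n. L2sq \<Omega> (\<lambda>u. f n u - g u)) \<longlonglongrightarrow> 0"
  proof (rule LIMSEQ_I)
    fix e :: real assume e: "e > 0"
    then have "e / 2 > 0" by simp
    from cauchy[OF this] obtain N where N: "\<And>m n. m \<ge> N \<Longrightarrow> n \<ge> N \<Longrightarrow> L2sq \<Omega> (\<lambda>u. f m u - f n u) \<le> e / 2"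
      by blast
    have "norm (L2sq \<Omega> (\<lambda>u. f m u - g u) - 0) < e" if "m \<ge> N" for m
      using diff[of N m "e/2"] N[OF that] e by simp
    then show "\<exists>N. \<forall>m\<ge>N. norm (L2sq \<Omega> (\<lambda>u. f m u - g u) - 0) < e"
      by blast
  qed
  ultimately show ?thesis
    by (rule that)
qed

lemma Ap2_Riesz:
  assumes \<Omega>: "open \<Omega>"
    and lin: "\<And>a b f g. Ap 2 \<Omega> f \<Longrightarrow> Ap 2 \<Omega> g \<Longrightarrow> \<phi> (\<lambda>u. a * f u + b * g u) = a * \<phi> f + b * \<phi> g"
    and B: "\<And>f. Ap 2 \<Omega> f \<Longrightarrow> (norm (\<phi> f))\<^sup>2 \<le> B * L2sq \<Omega> f"
  obtains k where "Ap 2 \<Omega> k" "\<And>f. Ap 2 \<Omega> f \<Longrightarrow> \<phi> f = L2ip \<Omega> f k"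
proof -
  \<comment> \<open>The representing function minimises \<open>J\<close>; minimising sequences are Cauchy by the parallelogram law.\<close>
  define J where "J f = L2sq \<Omega> f - 2 * Re (\<phi> f)" for f
  define m where "m = Inf (J ` Collect (Ap 2 \<Omega>))"
  \<comment> \<open>The quadratic term absorbs the linear one: \<open>4 * \<bar>B\<bar> * N\<close>
    is at most \<open>(N + \<bar>B\<bar>)\<^sup>2\<close>. The absolute value appears because the
    sign of \<open>B\<close> is not assumed.\<close>
  have J_lower: "J f \<ge> - \<bar>B\<bar> - 1" if "Ap 2 \<Omega> f" for f
  proof -
    define N where "N = L2sq \<Omega> f"
    have N: "N \<ge> 0"
      by (simp add: N_def)
    have "(norm (\<phi> f))\<^sup>2 \<le> \<bar>B\<bar> * N"
      using B[OF that] N by (smt (verit) N_def mult_right_mono)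
    also have "4 * (\<bar>B\<bar> * N) \<le> (N + \<bar>B\<bar>)\<^sup>2"
      using zero_le_power2[of "N - \<bar>B\<bar>"] by (simp add: power2_eq_square algebra_simps)
    finally have "(2 * norm (\<phi> f))\<^sup>2 \<le> (N + \<bar>B\<bar>)\<^sup>2"
      by (simp add: power_mult_distrib)
    then have "2 * norm (\<phi> f) \<le> N + \<bar>B\<bar>"
      by (rule power2_le_imp_le) (use N in auto)
    then show ?thesis
      using complex_Re_le_cmod[of "\<phi> f"] unfolding J_def N_def by linarith
  qed
  then have bdd: "bdd_below (J ` Collect (Ap 2 \<Omega>))"
    by (intro bdd_belowI2) auto
  have m_le: "m \<le> J f" if "Ap 2 \<Omega> f" for f
    unfolding m_def using that by (intro cInf_lower bdd) auto
  have "\<exists>f. Ap 2 \<Omega> f \<and> J f < m + 1 / Suc n" for n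
  proof -
    have "Inf (J ` Collect (Ap 2 \<Omega>)) < m + 1 / Suc n"
      by (simp add: m_def)
    then show ?thesis
      using Ap2_zero by (subst (asm) cInf_less_iff[OF _ bdd]) auto
  qed
  then obtain f where f: "\<And>n. Ap 2 \<Omega> (f n)" "\<And>n. J (f n) < m + 1 / Suc n"
    by metis
  \<comment> \<open>The midpoint of two near-minimisers has value at least \<open>m\<close>;
    expanding its norm bounds the norm of the difference.\<close>
  have par: "L2sq \<Omega> (\<lambda>u. f i u - f j u) \<le> 2 * (1 / Suc i) + 2 * (1 / Suc j)" for i j
  proof -
    have "m \<le> J (\<lambda>u. (1/2) * f i u + (1/2) * f j u)"
      by (intro m_le Ap2_lincomb f)
    also have "\<dots> = (1/4) * L2sq \<Omega> (f i) + (1/2) * Re (L2ip \<Omega> (f i) (f j)) + (1/4) * L2sq \<Omega> (f j)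
        - Re (\<phi> (f i)) - Re (\<phi> (f j))"
      unfolding J_def lin[OF f(1) f(1)] Lp2_lincomb(2)[OF Ap2_Lp[OF f(1)] Ap2_Lp[OF f(1)]]
      by (simp add: power2_eq_square)
    finally have 1: "m \<le> (1/4) * L2sq \<Omega> (f i) + (1/2) * Re (L2ip \<Omega> (f i) (f j)) + (1/4) * L2sq \<Omega> (f j)
        - Re (\<phi> (f i)) - Re (\<phi> (f j))" .
    have 2: "L2sq \<Omega> (\<lambda>u. f i u - f j u) = L2sq \<Omega> (f i) - 2 * Re (L2ip \<Omega> (f i) (f j)) + L2sq \<Omega> (f j)"
      using Lp2_lincomb(2)[OF Ap2_Lp[OF f(1)[of i]] Ap2_Lp[OF f(1)[of j]], of 1 "-1"] by simp
    show ?thesis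
      using 1 2 f(2)[of i] f(2)[of j] unfolding J_def by linarith
  qed
  have "\<exists>N. \<forall>i\<ge>N. \<forall>j\<ge>N. L2sq \<Omega> (\<lambda>u. f i u - f j u) \<le> e" if e: "e > 0" for e
  proof -
    obtain N where N: "1 / Suc N < e / 4"
      using e nat_approx_posE[of "e/4"] by auto
    have "L2sq \<Omega> (\<lambda>u. f i u - f j u) \<le> e" if "i \<ge> N" "j \<ge> N" for i j
    proof -
      have "1 / Suc i \<le> 1 / Suc N" "1 / Suc j \<le> 1 / Suc N"
        using that by (auto intro!: divide_left_mono)
      then show ?thesis
        using par[of i j] N by linarith
    qed
    then show ?thesis
      by blast
  qed
  from Ap2_complete[OF \<Omega> f(1) this] obtain k where
    k: "Ap 2 \<Omega> k" "(\<lambda>n. L2sq \<Omega> (\<lambda>u. f n u - k u)) \<longlonglongrightarrow> 0"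
    by blast
  have "\<phi> g = L2ip \<Omega> g k" if g: "Ap 2 \<Omega> g" for g
  proof -
    have limip: "(\<lambda>n. L2ip \<Omega> (f n) g) \<longlonglongrightarrow> L2ip \<Omega> k g"
    proof (rule LIM_zero_cancel, rule Lim_null_comparison)
      have d: "L2ip \<Omega> (f n) g - L2ip \<Omega> k g = L2ip \<Omega> (\<lambda>u. f n u - k u) g" for n
        using L2ip_lincomb_left[OF Ap2_Lp[OF f(1)[of n]] Ap2_Lp[OF k(1)] Ap2_Lp[OF g], of 1 "-1"] by simp
      show "\<forall>\<^sub>F n in sequentially. norm (L2ip \<Omega> (f n) g - L2ip \<Omega> k g)
          \<le> sqrt (L2sq \<Omega> (\<lambda>u. f n u - k u) * L2sq \<Omega> g)"
        unfolding d by (intro always_eventually allI real_le_rsqrt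
            L2_Cauchy_Schwarz Ap2_Lp Ap2_diff f k g)
      have "(\<lambda>n. sqrt (L2sq \<Omega> (\<lambda>u. f n u - k u) * L2sq \<Omega> g)) \<longlonglongrightarrow> sqrt (0 * L2sq \<Omega> g)"
        by (intro tendsto_intros k)
      then show "(\<lambda>n. sqrt (L2sq \<Omega> (\<lambda>u. f n u - k u) * L2sq \<Omega> g)) \<longlonglongrightarrow> 0"
        by simp
    qed
    define d where "d = L2ip \<Omega> k g - cnj (\<phi> g)"
    define G where "G = L2sq \<Omega> g"
    \<comment> \<open>First variation: moving \<open>f n\<close> by \<open>t g\<close> cannot lower
      \<open>J\<close> below \<open>m\<close>, and \<open>J (f n)\<close> exceeds \<open>m\<close>
      by less than \<open>1 / Suc n\<close>. The limit in \<open>n\<close> gives the inequality for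
      \<open>k\<close>.\<close>
    have var: "0 \<le> 2 * Re (cnj t * d) + (norm t)\<^sup>2 * G" for t
    proof (rule LIMSEQ_le_const)
      show "(\<lambda>n. 2 * Re (cnj t * (L2ip \<Omega> (f n) g - cnj (\<phi> g))) + (norm t)\<^sup>2 * G + 1 / Suc n)
          \<longlonglongrightarrow> 2 * Re (cnj t * d) + (norm t)\<^sup>2 * G"
      proof -
        have "(\<lambda>n. 2 * Re (cnj t * (L2ip \<Omega> (f n) g - cnj (\<phi> g))) + (norm t)\<^sup>2 * G + 1 / Suc n)
            \<longlonglongrightarrow> 2 * Re (cnj t * d) + (norm t)\<^sup>2 * G + 0"
          unfolding d_def by (intro tendsto_intros limip LIMSEQ_Suc[OF lim_1_over_n])
        then show ?thesis
          by simp
      qed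
      have "0 \<le> 2 * Re (cnj t * (L2ip \<Omega> (f n) g - cnj (\<phi> g))) + (norm t)\<^sup>2 * G + 1 / Suc n" for n
      proof -
        have "m \<le> J (\<lambda>u. 1 * f n u + t * g u)"
          by (intro m_le Ap2_lincomb f g)
        also have "\<dots> = J (f n) + 2 * Re (cnj t * (L2ip \<Omega> (f n) g - cnj (\<phi> g))) + (norm t)\<^sup>2 * G"
          unfolding J_def lin[OF f(1) g] Lp2_lincomb(2)[OF Ap2_Lp[OF f(1)] Ap2_Lp[OF g]]
          by (simp add: G_def algebra_simps)
        finally show ?thesis
          using f(2)[of n] by linarith
      qed
      then show "\<exists>N. \<forall>n\<ge>N. 0 \<le> 2 * Re (cnj t * (L2ip \<Omega> (f n) g - cnj (\<phi> g))) + (norm t)\<^sup>2 * G + 1 / Suc n"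
        by blast
    qed
    have "d = 0"
    proof (rule ccontr)
      assume "d \<noteq> 0"
      then have dp: "(norm d)\<^sup>2 > 0"
        by simp
      have G: "G \<ge> 0"
        by (simp add: G_def)
      \<comment> \<open>With \<open>t = - s d\<close> the quadratic term is at most half the size of
        the negative linear term, since \<open>s * G\<close> is at most 1; this contradicts
        \<open>var\<close> unless \<open>d = 0\<close>.\<close>
      define s where "s = 1 / (G + 1)"
      have s: "s > 0" "s * G \<le> 1"
        using G by (auto simp: s_def)
      have "0 \<le> 2 * Re (cnj (of_real (- s) * d) * d) + (norm (of_real (- s) * d))\<^sup>2 * G"
        by (rule var)
      also have "Re (cnj (of_real (- s) * d) * d) = - s * (norm d)\<^sup>2"
        unfolding cmod_power2 by (simp add: power2_eq_square algebra_simps)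
      also have "(norm (of_real (- s) * d))\<^sup>2 * G = s * (norm d)\<^sup>2 * (s * G)"
        by (simp add: norm_mult power2_eq_square)
      also have "s * (norm d)\<^sup>2 * (s * G) \<le> s * (norm d)\<^sup>2 * 1"
        using s dp by (intro mult_left_mono) auto
      also have "2 * (- s * (norm d)\<^sup>2) + s * (norm d)\<^sup>2 * 1 = - (s * (norm d)\<^sup>2)"
        by simp
      also have "\<dots> < 0"
        using s dp by simp
      finally show False
        by simp
    qed
    then have "L2ip \<Omega> k g = cnj (\<phi> g)"
      by (simp add: d_def)
    then show ?thesis
      by (simp add: L2ip_commute[of \<Omega> g k])
  qed
  with k(1) show ?thesis
    by (rule that)
qed

section \<open>The kernel and boundedness for exponent 2\<close>

text \<open>Justifies the \<open>THE\<close> in \<open>bergman_kernel\<close>. Riesz representation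
  of evaluation at \<open>z\<close> gives existence. The reproducing property fixes the values
  inside the domain, and the vanishing condition those outside.\<close>

lemma bergman_kernel_ex1:
  assumes \<Omega>: "open \<Omega>" and z: "z \<in> \<Omega>"
  shows "\<exists>!k. Ap 2 \<Omega> k \<and> (\<forall>u. u \<notin> \<Omega> \<longrightarrow> k u = 0) \<and>
      (\<forall>h. Ap 2 \<Omega> h \<longrightarrow> h z = (\<integral>u. h u * cnj (k u) \<partial>lebesgue_on \<Omega>))"
proof -
  obtain r C where rC: "r > 0" "\<And>f y. Ap 2 \<Omega> f \<Longrightarrow> y \<in> ball z r \<Longrightarrow> (norm (f y))\<^sup>2 \<le> C * L2sq \<Omega> f"
    using Ap2_locally_bounded[OF \<Omega> z] by metis
  have "(norm (f z))\<^sup>2 \<le> C * L2sq \<Omega> f" if "Ap 2 \<Omega> f" for f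
    using rC that by simp
  then obtain k where k: "Ap 2 \<Omega> k" "\<And>f. Ap 2 \<Omega> f \<Longrightarrow> f z = L2ip \<Omega> f k"
    using Ap2_Riesz[OF \<Omega>, of "\<lambda>f. f z" C] by auto
  define k0 where "k0 u = (if u \<in> \<Omega> then k u else 0)" for u
  have k0: "Ap 2 \<Omega> k0"
    using k(1) by (subst Ap_cong[OF \<Omega>, of k0 k]) (auto simp: k0_def)
  have "h z = (\<integral>u. h u * cnj (k0 u) \<partial>lebesgue_on \<Omega>)" if "Ap 2 \<Omega> h" for h
    unfolding k(2)[OF that] L2ip_def
    by (rule Bochner_Integration.integral_cong) (auto simp: k0_def space_restrict_space)
  then have ex: "Ap 2 \<Omega> k0 \<and> (\<forall>u. u \<notin> \<Omega> \<longrightarrow> k0 u = 0) \<and>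
      (\<forall>h. Ap 2 \<Omega> h \<longrightarrow> h z = (\<integral>u. h u * cnj (k0 u) \<partial>lebesgue_on \<Omega>))"
    using k0 by (simp add: k0_def)
  show ?thesis
  proof (rule ex1I[where a=k0], rule ex)
    fix l assume l: "Ap 2 \<Omega> l \<and> (\<forall>u. u \<notin> \<Omega> \<longrightarrow> l u = 0) \<and>
      (\<forall>h. Ap 2 \<Omega> h \<longrightarrow> h z = (\<integral>u. h u * cnj (l u) \<partial>lebesgue_on \<Omega>))"
    define d where "d u = l u - k0 u" for u
    have d: "Ap 2 \<Omega> d"
      unfolding d_def using l k0 by (intro Ap2_diff) auto
    \<comment> \<open>Both candidates represent evaluation at \<open>z\<close>, so they pair equally
      with their difference \<open>d\<close>, which is therefore orthogonal to itself.\<close>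
    have "L2ip \<Omega> l d = cnj (d z)" "L2ip \<Omega> k0 d = cnj (d z)"
    proof -
      have "d z = L2ip \<Omega> d l" "d z = L2ip \<Omega> d k0"
        using l ex d unfolding L2ip_def by blast+
      then show "L2ip \<Omega> l d = cnj (d z)" "L2ip \<Omega> k0 d = cnj (d z)"
        using L2ip_commute[of \<Omega> l d] L2ip_commute[of \<Omega> k0 d] by simp_all
    qed
    then have "L2ip \<Omega> d d = 0"
      using L2ip_lincomb_left[OF Ap2_Lp Ap2_Lp Ap2_Lp, of \<Omega> l k0 d 1 "-1"] l k0 d
      by (simp add: d_def[abs_def])
    then have "L2sq \<Omega> d = 0"
      using L2ip_self[OF Ap2_Lp[OF d]] by simp
    then have "d u = 0" if "u \<in> \<Omega>" for u
      using Ap2_eq_zero[OF \<Omega> d _ that] by simp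
    then show "l = k0"
      using l ex by (metis d_def eq_iff_diff_eq_0 ext)
  qed
qed

lemma bergman_kernel_reproducing:
  assumes "open \<Omega>" "z \<in> \<Omega>"
  shows "Ap 2 \<Omega> (\<lambda>w. cnj (bergman_kernel \<Omega> z w))"
    and "Ap 2 \<Omega> h \<Longrightarrow> L2ip \<Omega> h (\<lambda>w. cnj (bergman_kernel \<Omega> z w)) = h z"
  using theI'[OF bergman_kernel_ex1[OF assms]] by (auto simp: bergman_kernel_def L2ip_def)

lemma bergman_proj_eq_L2ip: "bergman_proj \<Omega> f z = L2ip \<Omega> f (\<lambda>w. cnj (bergman_kernel \<Omega> z w))"
  by (simp add: bergman_proj_def L2ip_def mult.commute)

text \<open>The pairing hypothesis characterises \<open>h\<close> as the projection of
  \<open>f\<close>; testing it with the kernel function of \<open>z\<close> yields the value of the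
  integral formula at \<open>z\<close>.\<close>

lemma bergman_proj_eqI:
  assumes \<Omega>: "open \<Omega>" "z \<in> \<Omega>" and h: "Ap 2 \<Omega> h" and eq: "\<And>g. Ap 2 \<Omega> g \<Longrightarrow> L2ip \<Omega> g f = L2ip \<Omega> g h"
  shows "bergman_proj \<Omega> f z = h z"
  using eq[OF bergman_kernel_reproducing(1)[OF \<Omega>]] bergman_kernel_reproducing(2)[OF \<Omega> h]
  by (simp add: bergman_proj_eq_L2ip L2ip_commute[of \<Omega> _ "\<lambda>w. cnj (bergman_kernel \<Omega> z w)"])

lemma bergman_Lp_bounded_2:
  assumes \<Omega>: "open \<Omega>"
  shows "bergman_Lp_bounded 2 \<Omega>"
  unfolding bergman_Lp_bounded_def
proof (intro exI[where x=1] allI impI conjI ballI)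
  fix f assume f: "Lp 2 \<Omega> f"
  show "integrable (lebesgue_on \<Omega>) (\<lambda>w. bergman_kernel \<Omega> z w * f w)" if "z \<in> \<Omega>" for z
    using Lp2_mult_integrable[OF f Ap2_Lp[OF bergman_kernel_reproducing(1)[OF \<Omega> that]]]
    by (simp add: mult.commute)
  obtain h where h: "Ap 2 \<Omega> h" "\<And>g. Ap 2 \<Omega> g \<Longrightarrow> L2ip \<Omega> g f = L2ip \<Omega> g h"
  proof (rule Ap2_Riesz[OF \<Omega>, of "\<lambda>g. L2ip \<Omega> g f" "L2sq \<Omega> f"])
    show "L2ip \<Omega> (\<lambda>u. a * g u + b * g' u) f = a * L2ip \<Omega> g f + b * L2ip \<Omega> g' f"
      if "Ap 2 \<Omega> g" "Ap 2 \<Omega> g'" for a b g g'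
      by (rule L2ip_lincomb_left[OF Ap2_Lp[OF that(1)] Ap2_Lp[OF that(2)] f])
    show "(norm (L2ip \<Omega> g f))\<^sup>2 \<le> L2sq \<Omega> f * L2sq \<Omega> g" if "Ap 2 \<Omega> g" for g
      using L2_Cauchy_Schwarz[OF Ap2_Lp[OF that] f] by (simp add: mult.commute)
  qed blast
  have eq: "bergman_proj \<Omega> f z = h z" if "z \<in> \<Omega>" for z
    using bergman_proj_eqI[OF \<Omega> that h] .
  show "Ap 2 \<Omega> (bergman_proj \<Omega> f)"
    using h(1) eq by (subst Ap_cong[OF \<Omega>, of _ h]) auto
  have "(\<integral>w. (norm (bergman_proj \<Omega> f w))\<^sup>2 \<partial>lebesgue_on \<Omega>) = L2sq \<Omega> h"
    unfolding L2sq_def by (rule Bochner_Integration.integral_cong) (auto simp: eq space_restrict_space)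
  moreover have "L2sq \<Omega> h \<le> L2sq \<Omega> f"
  proof -
    \<comment> \<open>Testing \<open>h\<close> against itself gives that
      \<open>L2ip \<Omega> h f\<close> is the squared norm of \<open>h\<close>; Cauchy-Schwarz then
      makes the projection a contraction.\<close>
    have "(L2sq \<Omega> h)\<^sup>2 \<le> L2sq \<Omega> h * L2sq \<Omega> f"
      using L2_Cauchy_Schwarz[OF Ap2_Lp[OF h(1)] f] h(2)[OF h(1)] L2ip_self[OF Ap2_Lp[OF h(1)]] by simp
    then show ?thesis
      by (cases "L2sq \<Omega> h = 0") (auto simp: power2_eq_square less_le)
  qed
  ultimately show "Lp_norm 2 \<Omega> (bergman_proj \<Omega> f) \<le> 1 * Lp_norm 2 \<Omega> f"
    by (simp add: Lp_norm_def L2sq_def powr_mono2)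
qed

section \<open>Laurent coefficients on the Hartogs triangle\<close>

text \<open>Up to the factor \<open>2 * pi * \<i>\<close> the circle mean is the contour integral of
  \<open>E z / z\<close>, and circles about 0 are homotopic in the annulus. The case
  \<open>r = 0\<close> covers punctured discs.\<close>

lemma annulus_mean_eq:
  fixes E :: "complex \<Rightarrow> complex"
  assumes hol: "E holomorphic_on {z. r < norm z \<and> norm z < R}" and r: "0 \<le> r"
    and z: "r < norm z1" "norm z1 < R" "r < norm z2" "norm z2 < R"
  shows "integral {0..1} (\<lambda>t. E (ecirc t * z1)) = integral {0..1} (\<lambda>t. E (ecirc t * z2))"
proof -
  define A where "A = {z::complex. r < norm z \<and> norm z < R}"
  have oA: "open A"
    unfolding A_def by (intro open_Collect_conj open_Collect_less continuous_intros)
  have holE: "(\<lambda>z. E z / z) holomorphic_on A"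
    using hol r unfolding A_def by (intro holomorphic_intros) auto
  define \<gamma> where "\<gamma> = (\<lambda>z t. ecirc t * z)"
  have deriv: "(\<gamma> z has_vector_derivative (2 * of_real pi * \<i>) * \<gamma> z t) (at t)" for z t
  proof -
    have "((\<lambda>x. exp (2 * of_real pi * \<i> * x) * z) has_field_derivative
        (2 * of_real pi * \<i>) * \<gamma> z t) (at (of_real t))"
      unfolding \<gamma>_def ecirc_def by (auto intro!: derivative_eq_intros)
    from has_vector_derivative_real_field[OF this] show ?thesis
      by (simp add: \<gamma>_def[abs_def] ecirc_def[abs_def])
  qed
  have vp: "valid_path (\<gamma> z)" for z
  proof -
    have "\<gamma> z C1_differentiable_on {0..1}"
      unfolding C1_differentiable_on_def
      using deriv by (intro exI[where x="\<lambda>t. (2 * of_real pi * \<i>) * \<gamma> z t"])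
        (auto intro!: continuous_intros simp: \<gamma>_def)
    then show ?thesis
      by (simp add: valid_path_def C1_differentiable_imp_piecewise)
  qed
  have ci: "contour_integral (\<gamma> z) (\<lambda>z. E z / z) = (2 * of_real pi * \<i>) * integral {0..1} (\<lambda>t. E (ecirc t * z))"
    if "z \<noteq> 0" for z
  proof -
    have "contour_integral (\<gamma> z) (\<lambda>z. E z / z)
        = integral {0..1} (\<lambda>t. E (\<gamma> z t) / \<gamma> z t * vector_derivative (\<gamma> z) (at t))"
      by (simp add: contour_integral_integral)
    also have "\<dots> = integral {0..1} (\<lambda>t. (2 * of_real pi * \<i>) * E (ecirc t * z))"
      using that vector_derivative_at[OF deriv, of z]
      by (intro integral_cong) (simp add: \<gamma>_def)
    finally show ?thesis
      by simp
  qed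
  have nz: "z1 \<noteq> 0" "z2 \<noteq> 0"
    using r z by auto
  \<comment> \<open>Interpolating logarithms moves the starting point from \<open>z1\<close> to
    \<open>z2\<close>: the modulus is a weighted geometric mean of the two moduli, so it stays
    between them.\<close>
  define h where "h = (\<lambda>(s::real, t). ecirc t * exp ((1 - s) *\<^sub>R Ln z1 + s *\<^sub>R Ln z2))"
  have hA: "h (s, t) \<in> A" if "s \<in> {0..1}" for s t
  proof -
    have n: "norm (h (s, t)) = exp ((1 - s) * ln (norm z1) + s * ln (norm z2))"
      using nz by (simp add: h_def norm_mult)
    define l u where "l = min (norm z1) (norm z2)" and "u = max (norm z1) (norm z2)"
    have lu: "0 < l" "r < l" "u < R" "l \<le> norm z1" "l \<le> norm z2" "norm z1 \<le> u" "norm z2 \<le> u"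
      using z nz by (auto simp: l_def u_def)
    have "(1 - s) * ln l + s * ln l \<le> (1 - s) * ln (norm z1) + s * ln (norm z2)"
      using that lu nz by (intro add_mono mult_left_mono) auto
    then have 1: "ln l \<le> (1 - s) * ln (norm z1) + s * ln (norm z2)"
      by (simp add: algebra_simps)
    have "(1 - s) * ln (norm z1) + s * ln (norm z2) \<le> (1 - s) * ln u + s * ln u"
      using that lu nz by (intro add_mono mult_left_mono) (auto simp: ln_mono intro: less_le_trans)
    then have 2: "(1 - s) * ln (norm z1) + s * ln (norm z2) \<le> ln u"
      by (simp add: algebra_simps)
    have "0 < u"
      using lu by linarith
    moreover have "exp (ln l) \<le> norm (h (s, t))" "norm (h (s, t)) \<le> exp (ln u)"
      using 1 2 unfolding n by simp_all
    ultimately have "l \<le> norm (h (s, t))" "norm (h (s, t)) \<le> u"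
      using lu(1) by simp_all
    then show ?thesis
      using lu by (simp add: A_def)
  qed
  have "homotopic_loops A (\<gamma> z1) (\<gamma> z2)"
    unfolding homotopic_loops
  proof (intro exI[where x=h] conjI ballI)
    show "continuous_on ({0..1} \<times> {0..1}) h"
      unfolding h_def case_prod_beta by (intro continuous_intros)
    show "h \<in> {0..1} \<times> {0..1} \<rightarrow> A"
      using hA by auto
    show "h (0, t) = \<gamma> z1 t" "h (1, t) = \<gamma> z2 t" for t
      using nz by (auto simp: h_def \<gamma>_def)
    show "pathfinish (h \<circ> Pair t) = pathstart (h \<circ> Pair t)" for t
      by (simp add: pathfinish_def pathstart_def h_def ecirc_def)
  qed
  from Cauchy_theorem_homotopic_loops[OF this oA holE vp vp] show ?thesis
    using nz by (simp add: ci)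
qed

section \<open>Torus means and their independence of the point\<close>

text \<open>For \<open>E\<close> equal to \<open>g\<close> divided by a Laurent monomial this is the
  corresponding Laurent coefficient of \<open>g\<close>.\<close>

definition torus_mean :: "(complex \<times> complex \<Rightarrow> complex) \<Rightarrow> complex \<times> complex \<Rightarrow> complex" where
  "torus_mean E w = integral {0..1} (\<lambda>t. integral {0..1} (\<lambda>s. E (ecirc s * fst w, ecirc t * snd w)))"

text \<open>Dividing by a monomial requires \<open>fst w\<close> to be nonzero; the removed axis is
  a null set.\<close>

definition Hgamma_punct :: "real \<Rightarrow> (complex \<times> complex) set" where
  "Hgamma_punct \<gamma> = {w \<in> Hgamma \<gamma>. fst w \<noteq> 0}"

lemma Hgamma_iff: "w \<in> Hgamma \<gamma> \<longleftrightarrow> norm (fst w) powr \<gamma> < norm (snd w) \<and> norm (snd w) < 1"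
  by (auto simp: Hgamma_def)

lemma open_Hgamma:
  assumes "\<gamma> > 0"
  shows "open (Hgamma \<gamma>)"
proof -
  have "Hgamma \<gamma> = {w. norm (fst w) powr \<gamma> < norm (snd w)} \<inter> {w. norm (snd w) < 1}"
    by (auto simp: Hgamma_iff)
  moreover have "continuous_on UNIV (\<lambda>w::complex \<times> complex. norm (fst w) powr \<gamma>)"
    using assms by (intro continuous_on_powr' continuous_intros) auto
  ultimately show ?thesis
    by (auto intro!: open_Int open_Collect_less continuous_intros)
qed

lemma Hgamma_rotate:
  assumes "norm u = 1" "norm v = 1"
  shows "(u * x, v * y) \<in> Hgamma \<gamma> \<longleftrightarrow> (x, y) \<in> Hgamma \<gamma>"
  using assms by (simp add: Hgamma_iff norm_mult)

lemma Hgamma_snd_nonzero: "w \<in> Hgamma \<gamma> \<Longrightarrow> snd w \<noteq> 0"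
  by (auto simp: Hgamma_iff)

lemma holo2_slices:
  assumes E: "holo2 E \<Omega>"
  shows "(\<And>z. z \<in> S \<Longrightarrow> (z, y) \<in> \<Omega>) \<Longrightarrow> (\<lambda>z. E (z, y)) holomorphic_on S"
    and "(\<And>z. z \<in> S \<Longrightarrow> (x, z) \<in> \<Omega>) \<Longrightarrow> (\<lambda>z. E (x, z)) holomorphic_on S"
  using holo2_line[OF E, of S "(0, y)" "(1, 0)"] holo2_line[OF E, of S "(x, 0)" "(0, 1)"]
  by (auto simp: scaleC2_def)

text \<open>Making the second coordinate the inner variable lets the annulus argument be applied to
  it as well.\<close>

lemma torus_mean_swap:
  assumes E: "continuous_on (Hgamma_punct \<gamma>) E" and w: "(x, y) \<in> Hgamma_punct \<gamma>"
  shows "torus_mean E (x, y) = integral {0..1} (\<lambda>s. integral {0..1} (\<lambda>t. E (ecirc s * x, ecirc t * y)))"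
proof -
  have "continuous_on (cbox (0, 0) (1, 1)) (\<lambda>(t, s). E (ecirc s * x, ecirc t * y))"
    unfolding case_prod_beta
    by (rule continuous_on_compose2[OF E])
       (use w in \<open>auto intro!: continuous_intros simp: Hgamma_punct_def Hgamma_rotate\<close>)
  from integral_swap_continuous[OF this] show ?thesis
    by (simp add: torus_mean_def)
qed

text \<open>One coordinate is moved at a time: the slices in the first coordinate are punctured
  discs, those in the second are annuli, and \<open>annulus_mean_eq\<close> applies to the inner
  integral in each case.\<close>

lemma torus_mean_const:
  assumes \<gamma>: "\<gamma> > 0" and E: "holo2 E (Hgamma_punct \<gamma>)"
    and w: "w \<in> Hgamma_punct \<gamma>" "w' \<in> Hgamma_punct \<gamma>"
  shows "torus_mean E w = torus_mean E w'"
proof -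
  have c: "continuous_on (Hgamma_punct \<gamma>) E"
    by (rule holo2_imp_continuous_on[OF E])
  have fst_eq: "torus_mean E (x, y) = torus_mean E (x', y)"
    if "(x, y) \<in> Hgamma_punct \<gamma>" "(x', y) \<in> Hgamma_punct \<gamma>" for x x' y
    unfolding torus_mean_def
  proof (rule integral_cong)
    fix t
    \<comment> \<open>The radius of the slice of the domain at height \<open>y\<close>.\<close>
    define R where "R = norm y powr (1/\<gamma>)"
    have iff: "norm z < R \<longleftrightarrow> norm z powr \<gamma> < norm y" for z :: complex
    proof -
      have "norm z < R \<longleftrightarrow> norm z powr \<gamma> < R powr \<gamma>"
        using powr_less_mono2[OF \<gamma>, of "norm z" R] powr_mono2[of \<gamma> R "norm z"] \<gamma>
        by (auto simp: R_def not_less[symmetric])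
      then show ?thesis
        using \<gamma> by (simp add: R_def powr_powr)
    qed
    have "(\<lambda>z. E (z, ecirc t * y)) holomorphic_on {z. 0 < norm z \<and> norm z < R}"
      using that(1) by (intro holo2_slices[OF E]) (auto simp: Hgamma_punct_def Hgamma_iff norm_mult iff)
    then show "integral {0..1} (\<lambda>s. E (ecirc s * fst (x, y), ecirc t * snd (x, y)))
        = integral {0..1} (\<lambda>s. E (ecirc s * fst (x', y), ecirc t * snd (x', y)))"
      unfolding fst_conv snd_conv
      by (rule annulus_mean_eq) (use that in \<open>auto simp: Hgamma_punct_def Hgamma_iff iff\<close>)
  qed
  have snd_eq: "torus_mean E (x, y) = torus_mean E (x, y')"
    if "(x, y) \<in> Hgamma_punct \<gamma>" "(x, y') \<in> Hgamma_punct \<gamma>" for x y y'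
    unfolding torus_mean_swap[OF c that(1)] torus_mean_swap[OF c that(2)]
  proof (rule integral_cong)
    fix s
    have "(\<lambda>z. E (ecirc s * x, z)) holomorphic_on {z. norm x powr \<gamma> < norm z \<and> norm z < 1}"
      using that(1) by (intro holo2_slices[OF E]) (auto simp: Hgamma_punct_def Hgamma_iff norm_mult)
    then show "integral {0..1} (\<lambda>t. E (ecirc s * x, ecirc t * y)) = integral {0..1} (\<lambda>t. E (ecirc s * x, ecirc t * y'))"
      by (rule annulus_mean_eq) (use that in \<open>auto simp: Hgamma_punct_def Hgamma_iff\<close>)
  qed
  obtain x y x' y' where xy: "w = (x, y)" "w' = (x', y')"
    by (metis surj_pair)
  \<comment> \<open>Both points are joined to points with the same small first coordinate.\<close>
  define v where "v = (if norm x \<le> norm x' then x else x')"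
  have v: "v \<noteq> 0" "norm v \<le> norm x" "norm v \<le> norm x'"
    using w by (auto simp: v_def xy Hgamma_punct_def)
  have "norm v powr \<gamma> \<le> norm x powr \<gamma>" "norm v powr \<gamma> \<le> norm x' powr \<gamma>"
    using v \<gamma> by (auto intro!: powr_mono2)
  then have "(v, y) \<in> Hgamma_punct \<gamma>" "(v, y') \<in> Hgamma_punct \<gamma>"
    using w v(1) by (auto simp: xy Hgamma_punct_def Hgamma_iff)
  then show ?thesis
    using fst_eq snd_eq w unfolding xy by metis
qed

section \<open>Laurent monomials and extraction of coefficients\<close>

text \<open>The first exponent is natural because the domain meets \<open>fst w = 0\<close>; the
  second may be negative because \<open>snd w\<close> never vanishes on it.\<close>

definition lmonom :: "nat \<Rightarrow> int \<Rightarrow> complex \<times> complex \<Rightarrow> complex" where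
  "lmonom a b w = fst w ^ a * snd w powi b"

lemma holo2_fst_snd:
  assumes "\<And>z. z \<in> \<Omega> \<Longrightarrow> \<phi> field_differentiable at (fst z)" "\<And>z. z \<in> \<Omega> \<Longrightarrow> \<psi> field_differentiable at (snd z)"
  shows "holo2 (\<lambda>z. \<phi> (fst z)) \<Omega>" "holo2 (\<lambda>z. \<psi> (snd z)) \<Omega>"
proof -
  have "\<exists>L. ((\<lambda>z. \<phi> (fst z)) has_derivative L) (at z) \<and> (\<forall>c v. L (scaleC2 c v) = c * L v)" if "z \<in> \<Omega>" for z
  proof -
    obtain D where "(\<phi> has_derivative (*) D) (at (fst z))"
      using assms(1)[OF \<open>z \<in> \<Omega>\<close>] by (auto simp: field_differentiable_def has_field_derivative_def)
    from has_derivative_compose[OF has_derivative_fst[OF has_derivative_ident] this] show ?thesis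
      by (intro exI[where x="\<lambda>v. D * fst v"]) (auto simp: scaleC2_def)
  qed
  then show "holo2 (\<lambda>z. \<phi> (fst z)) \<Omega>"
    by (simp add: holo2_def)
  have "\<exists>L. ((\<lambda>z. \<psi> (snd z)) has_derivative L) (at z) \<and> (\<forall>c v. L (scaleC2 c v) = c * L v)" if "z \<in> \<Omega>" for z
  proof -
    obtain D where "(\<psi> has_derivative (*) D) (at (snd z))"
      using assms(2)[OF \<open>z \<in> \<Omega>\<close>] by (auto simp: field_differentiable_def has_field_derivative_def)
    from has_derivative_compose[OF has_derivative_snd[OF has_derivative_ident] this] show ?thesis
      by (intro exI[where x="\<lambda>v. D * snd v"]) (auto simp: scaleC2_def)
  qed
  then show "holo2 (\<lambda>z. \<psi> (snd z)) \<Omega>"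
    by (simp add: holo2_def)
qed

lemma field_differentiable_powi:
  fixes z :: complex
  shows "z \<noteq> 0 \<Longrightarrow> (\<lambda>z. z powi b) field_differentiable at z"
  by (rule holomorphic_on_imp_differentiable_at[of _ "-{0}"])
     (auto intro!: holomorphic_intros)

lemma holo2_lmonom: "holo2 (lmonom a b) (Hgamma \<gamma>)"
proof -
  have "holo2 (\<lambda>w. fst w ^ a * snd w powi b) (Hgamma \<gamma>)"
    by (intro holo2_mult holo2_fst_snd[where \<phi>="\<lambda>z. z ^ a" and \<psi>="\<lambda>z. z powi b"] field_differentiable_powi)
       (auto intro!: derivative_intros dest: Hgamma_snd_nonzero)
  then show ?thesis
    by (simp add: lmonom_def[abs_def])
qed

lemma holo2_inverse_lmonom: "holo2 (\<lambda>w. inverse (lmonom a b w)) (Hgamma_punct \<gamma>)"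
proof -
  have "holo2 (\<lambda>w. fst w powi (- int a) * snd w powi (-b)) (Hgamma_punct \<gamma>)"
    by (intro holo2_mult holo2_fst_snd[where \<phi>="\<lambda>z. z powi (- int a)" and \<psi>="\<lambda>z. z powi (-b)"] field_differentiable_powi)
       (auto dest: Hgamma_snd_nonzero simp: Hgamma_punct_def)
  then show ?thesis
    by (simp add: lmonom_def power_int_minus)
qed

lemma lmonom_nonzero: "w \<in> Hgamma_punct \<gamma> \<Longrightarrow> lmonom a b w \<noteq> 0"
  by (auto simp: lmonom_def Hgamma_punct_def dest: Hgamma_snd_nonzero)

lemma norm_lmonom_rotate: "norm u = 1 \<Longrightarrow> norm v = 1 \<Longrightarrow> norm (lmonom a b (u * x, v * y)) = norm (lmonom a b (x, y))"
  by (simp add: lmonom_def norm_mult norm_power norm_power_int power_mult_distrib power_int_mult_distrib)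

lemma borel_measurable_lmonom [measurable]: "lmonom a b \<in> borel_measurable borel"
proof -
  have [measurable]: "(fst :: complex \<times> complex \<Rightarrow> complex) \<in> borel \<rightarrow>\<^sub>M borel"
    "(snd :: complex \<times> complex \<Rightarrow> complex) \<in> borel \<rightarrow>\<^sub>M borel"
    by (intro borel_measurable_continuous_onI continuous_intros)+
  have "(\<lambda>w. lmonom a b w) \<in> borel_measurable borel"
    unfolding lmonom_def power_int_def by (cases "b \<ge> 0") (simp_all, measurable)
  then show ?thesis by simp
qed

lemma AE_fst_nonzero: "AE w in (lborel :: (complex \<times> complex) measure). fst w \<noteq> 0"
proof -
  \<comment> \<open>The inner product with \<open>(1, 0)\<close> is \<open>Re (fst w)\<close>, so
    this real hyperplane contains every point with \<open>fst w = 0\<close>.\<close>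
  have "negligible {w::complex \<times> complex. w \<bullet> (1, 0) = 0}"
    by (rule negligible_standard_hyperplane) (simp add: Basis_prod_def Basis_complex_def)
  moreover have "closed {w::complex \<times> complex. w \<bullet> (1, 0) = 0}"
    by (intro closed_Collect_eq continuous_intros)
  ultimately have "{w::complex \<times> complex. w \<bullet> (1, 0) = 0} \<in> null_sets lborel"
    by (simp add: negligible_iff_null_sets null_sets_completion_iff borel_closed)
  then show ?thesis
    by (rule AE_I') (auto simp: inner_prod_def)
qed

text \<open>Two applications of \<open>integral_average\<close>, one for each rotated
  coordinate.\<close>

lemma torus_average:
  fixes H :: "complex \<times> complex \<Rightarrow> complex"
  assumes H: "integrable lborel H"
  defines "A \<equiv> \<lambda>w. \<integral>t. (\<integral>s. H (ecirc s * fst w, ecirc t * snd w) \<partial>unit_itv) \<partial>unit_itv"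
  shows "integrable lborel A" "(\<integral>w. A w \<partial>lborel) = (\<integral>w. H w \<partial>lborel)"
proof -
  define T1 T2 where "T1 = (\<lambda>s (w::complex \<times> complex). (ecirc s * fst w, 1 * snd w))"
    and "T2 = (\<lambda>t (w::complex \<times> complex). (1 * fst w, ecirc t * snd w))"
  have m: "(\<lambda>(t, w). T1 t w) \<in> borel \<Otimes>\<^sub>M borel \<rightarrow>\<^sub>M borel" "(\<lambda>(t, w). T2 t w) \<in> borel \<Otimes>\<^sub>M borel \<rightarrow>\<^sub>M borel"
    unfolding T1_def T2_def borel_prod case_prod_beta
    by (intro borel_measurable_continuous_onI continuous_intros)+
  have inv: "distr lborel borel (T1 t) = lborel" "distr lborel borel (T2 t) = lborel" for t
    unfolding T1_def T2_def by (intro lborel_rotate_C2; simp)+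
  define A1 where "A1 = (\<lambda>w. \<integral>s. H (T1 s w) \<partial>unit_itv)"
  note 1 = integral_average[OF m(1) inv(1) H, folded A1_def]
  note 2 = integral_average[OF m(2) inv(2) 1(1)]
  have A: "A = (\<lambda>w. \<integral>t. A1 (T2 t w) \<partial>unit_itv)"
    by (simp add: A_def A1_def T1_def T2_def)
  show "integrable lborel A" "(\<integral>w. A w \<partial>lborel) = (\<integral>w. H w \<partial>lborel)"
    using 2 1 by (simp_all add: A)
qed

text \<open>Links the Lebesgue integrals coming from Fubini with the gauge integrals coming from
  contour integration; continuity on the torus through \<open>w\<close> makes them agree.\<close>

lemma torus_mean_bochner:
  assumes E: "continuous_on (Hgamma_punct \<gamma>) E" and w: "w \<in> Hgamma_punct \<gamma>"
  shows "(\<integral>t. (\<integral>s. E (ecirc s * fst w, ecirc t * snd w) \<partial>unit_itv) \<partial>unit_itv) = torus_mean E w"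
proof -
  have in_punct: "(ecirc s * fst w, ecirc t * snd w) \<in> Hgamma_punct \<gamma>" for s t
    using w by (simp add: Hgamma_punct_def Hgamma_rotate)
  have "continuous_on {0..1} (\<lambda>s. E (ecirc s * fst w, ecirc t * snd w))" for t
    by (rule continuous_on_compose2[OF E]) (auto intro!: continuous_intros simp: in_punct)
  then have 1: "(\<integral>s. E (ecirc s * fst w, ecirc t * snd w) \<partial>unit_itv)
      = integral {0..1} (\<lambda>s. E (ecirc s * fst w, ecirc t * snd w))" for t
    by (rule integral_unit_itv)
  have "continuous_on ({0..1} \<times> cbox 0 1) (\<lambda>(t, s). E (ecirc s * fst w, ecirc t * snd w))"
    unfolding case_prod_beta
    by (rule continuous_on_compose2[OF E]) (auto intro!: continuous_intros simp: in_punct)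
  then have "continuous_on {0..1} (\<lambda>t. integral (cbox 0 1) (\<lambda>s. E (ecirc s * fst w, ecirc t * snd w)))"
    by (rule integral_continuous_on_param)
  then show ?thesis
    unfolding 1 torus_mean_def by (subst integral_unit_itv) auto
qed

text \<open>With \<open>E\<close> the quotient of \<open>g\<close> by the monomial, the integrand is
  \<open>E\<close> times the torus-invariant factor
  \<open>(norm (lmonom a b w))\<^sup>2 * \<rho> w\<close>, so averaging replaces \<open>E\<close> by
  its constant torus mean \<open>C\<close>. Since \<open>C\<close> is fixed before
  \<open>\<rho>\<close>, different weights can be compared, and integrability is transferred along
  with the value.\<close>

lemma lmonom_coefficient:
  assumes \<gamma>: "\<gamma> > 0" and g: "holo2 g (Hgamma \<gamma>)"
  obtains C :: complex where
    "\<And>\<rho> :: complex \<times> complex \<Rightarrow> real. \<rho> \<in> borel_measurable borel \<Longrightarrow>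
      (\<And>u v x y. norm u = 1 \<Longrightarrow> norm v = 1 \<Longrightarrow> \<rho> (u * x, v * y) = \<rho> (x, y)) \<Longrightarrow>
      integrable lborel (\<lambda>w. indicator (Hgamma \<gamma>) w *\<^sub>R (g w * cnj (lmonom a b w) * of_real (\<rho> w))) \<Longrightarrow>
      integrable lborel (\<lambda>w. indicator (Hgamma \<gamma>) w *\<^sub>R (C * of_real ((norm (lmonom a b w))\<^sup>2 * \<rho> w))) \<and>
      (\<integral>w. indicator (Hgamma \<gamma>) w *\<^sub>R (g w * cnj (lmonom a b w) * of_real (\<rho> w)) \<partial>lborel)
        = (\<integral>w. indicator (Hgamma \<gamma>) w *\<^sub>R (C * of_real ((norm (lmonom a b w))\<^sup>2 * \<rho> w)) \<partial>lborel)"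
proof
  define E where "E w = g w * inverse (lmonom a b w)" for w
  have E: "holo2 E (Hgamma_punct \<gamma>)"
    unfolding E_def
    by (intro holo2_mult holo2_inverse_lmonom holo2_subset[OF g]) (auto simp: Hgamma_punct_def)
  \<comment> \<open>The base point is arbitrary, as the torus mean is the same at every point of the
    punctured domain.\<close>
  define C where "C = torus_mean E (SOME w. w \<in> Hgamma_punct \<gamma>)"
  fix \<rho> :: "complex \<times> complex \<Rightarrow> real"
  assume \<rho>[measurable]: "\<rho> \<in> borel_measurable borel"
    and inv: "\<And>u v x y. norm u = 1 \<Longrightarrow> norm v = 1 \<Longrightarrow> \<rho> (u * x, v * y) = \<rho> (x, y)"
    and int: "integrable lborel (\<lambda>w. indicator (Hgamma \<gamma>) w *\<^sub>R (g w * cnj (lmonom a b w) * of_real (\<rho> w)))"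
  have [measurable]: "Hgamma \<gamma> \<in> sets borel"
    using open_Hgamma[OF \<gamma>] by simp
  define H where "H = (\<lambda>w. indicator (Hgamma \<gamma>) w *\<^sub>R (g w * cnj (lmonom a b w) * of_real (\<rho> w)))"
  define A where "A = (\<lambda>w. \<integral>t. (\<integral>s. H (ecirc s * fst w, ecirc t * snd w) \<partial>unit_itv) \<partial>unit_itv)"
  define B where "B = (\<lambda>w. indicator (Hgamma \<gamma>) w *\<^sub>R (C * of_real ((norm (lmonom a b w))\<^sup>2 * \<rho> w)))"
  have A: "integrable lborel A" "(\<integral>w. A w \<partial>lborel) = (\<integral>w. H w \<partial>lborel)"
    using torus_average[OF int] unfolding A_def H_def .
  have [measurable]: "A \<in> borel_measurable borel"
    using A(1) by simp
  have B[measurable]: "B \<in> borel_measurable borel"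
    unfolding B_def by measurable
  have AB: "A w = B w" if "fst w \<noteq> 0" for w
  proof (cases "w \<in> Hgamma \<gamma>")
    case True
    then have w: "w \<in> Hgamma_punct \<gamma>"
      using that by (simp add: Hgamma_punct_def)
    have "H (ecirc s * fst w, ecirc t * snd w)
        = E (ecirc s * fst w, ecirc t * snd w) * of_real ((norm (lmonom a b w))\<^sup>2 * \<rho> w)" for s t
    proof -
      define w' where "w' = (ecirc s * fst w, ecirc t * snd w)"
      have w': "w' \<in> Hgamma_punct \<gamma>" "w' \<in> Hgamma \<gamma>"
        using w by (auto simp: w'_def Hgamma_punct_def Hgamma_rotate)
      have "cnj (lmonom a b w') = inverse (lmonom a b w') * of_real ((norm (lmonom a b w'))\<^sup>2)"
        using lmonom_nonzero[OF w'(1), of a b]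
        by (simp add: complex_norm_square field_simps del: of_real_power)
      moreover have "norm (lmonom a b w') = norm (lmonom a b w)" "\<rho> w' = \<rho> w"
        using norm_lmonom_rotate[of "ecirc s" "ecirc t" a b "fst w" "snd w"] inv[of "ecirc s" "ecirc t" "fst w" "snd w"]
        by (auto simp: w'_def)
      ultimately show ?thesis
        using w'(2) by (simp add: H_def E_def flip: w'_def)
    qed
    then have "A w = torus_mean E w * of_real ((norm (lmonom a b w))\<^sup>2 * \<rho> w)"
      unfolding A_def torus_mean_bochner[OF holo2_imp_continuous_on[OF E] w, symmetric]
      by (simp only: integral_mult_left_zero)
    also have "torus_mean E w = C"
      unfolding C_def by (rule torus_mean_const[OF \<gamma> E w]) (rule someI[of "\<lambda>w. w \<in> Hgamma_punct \<gamma>", OF w])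
    finally show ?thesis
      using True by (simp add: B_def)
  next
    case False
    then have "H (ecirc s * fst w, ecirc t * snd w) = 0" for s t
      by (simp add: H_def Hgamma_rotate)
    then show ?thesis
      using False by (simp add: A_def B_def)
  qed
  have AE: "AE w in lborel. A w = B w"
    using AE_fst_nonzero by eventually_elim (rule AB)
  have "integrable lborel B"
    using A(1) AE by (subst (asm) integrable_cong_AE[of A lborel B]) auto
  moreover have "(\<integral>w. H w \<partial>lborel) = (\<integral>w. B w \<partial>lborel)"
    unfolding A(2)[symmetric] using AE by (intro integral_cong_AE) auto
  ultimately show "integrable lborel (\<lambda>w. indicator (Hgamma \<gamma>) w *\<^sub>R (C * of_real ((norm (lmonom a b w))\<^sup>2 * \<rho> w))) \<and>
      (\<integral>w. indicator (Hgamma \<gamma>) w *\<^sub>R (g w * cnj (lmonom a b w) * of_real (\<rho> w)) \<partial>lborel)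
        = (\<integral>w. indicator (Hgamma \<gamma>) w *\<^sub>R (C * of_real ((norm (lmonom a b w))\<^sup>2 * \<rho> w)) \<partial>lborel)"
    by (simp add: B_def H_def)
qed

section \<open>Integrability of monomials\<close>

definition disc_weight :: "real \<Rightarrow> real \<Rightarrow> ennreal" where
  "disc_weight s R = (\<integral>\<^sup>+z. indicator {z::complex. norm z < R} z * ennreal (norm z powr s) \<partial>lborel)"

lemma sets_norm_less [measurable]: "{z::complex. norm z < R} \<in> sets borel"
  by measurable

text \<open>The substitution \<open>R *\<^sub>R z\<close> contributes the planar Jacobian
  \<open>R^2\<close> and, by homogeneity of the weight, \<open>R powr s\<close>.\<close>

lemma disc_weight_scale:
  assumes R: "R > 0"
  shows "disc_weight s R = ennreal (R powr (s + 2)) * disc_weight s 1"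
proof -
  have "disc_weight s R = (\<integral>\<^sup>+z. indicator {z::complex. norm z < R} z * ennreal (norm z powr s)
      \<partial>density (distr lborel borel (\<lambda>x. 0 + R *\<^sub>R x)) (\<lambda>_. \<bar>R\<bar>^DIM(complex)))"
    using R unfolding disc_weight_def by (subst lborel_affine[of R 0, symmetric]) auto
  also have "\<dots> = (\<integral>\<^sup>+z. ennreal (R^2) * (indicator {z::complex. norm z < R} (R *\<^sub>R z) * ennreal (norm (R *\<^sub>R z) powr s)) \<partial>lborel)"
    using R by (simp add: nn_integral_density nn_integral_distr)
  also have "\<dots> = (\<integral>\<^sup>+z. ennreal (R powr (s + 2)) * (indicator {z::complex. norm z < 1} z * ennreal (norm z powr s)) \<partial>lborel)"
  proof (rule nn_integral_cong)
    fix z :: complex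
    have "ennreal (R^2) * ennreal (norm (R *\<^sub>R z) powr s) = ennreal (R powr (s + 2)) * ennreal (norm z powr s)"
      using R by (simp add: powr_mult powr_add powr_numeral ennreal_mult[symmetric] mult_ac)
    then show "ennreal (R^2) * (indicator {z::complex. norm z < R} (R *\<^sub>R z) * ennreal (norm (R *\<^sub>R z) powr s))
      = ennreal (R powr (s + 2)) * (indicator {z::complex. norm z < 1} z * ennreal (norm z powr s))"
      using R by (auto simp: indicator_def)
  qed
  also have "\<dots> = ennreal (R powr (s + 2)) * disc_weight s 1"
    unfolding disc_weight_def by (rule nn_integral_cmult) measurable
  finally show ?thesis .
qed

lemma annulus_weight_nonzero:
  "(\<integral>\<^sup>+z. indicator {z::complex. 1/2 \<le> norm z \<and> norm z < 1} z * ennreal (norm z powr s) \<partial>lborel) \<noteq> 0"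
proof
  let ?A = "{z::complex. 1/2 \<le> norm z \<and> norm z < 1}"
  assume "(\<integral>\<^sup>+z. indicator ?A z * ennreal (norm z powr s) \<partial>lborel) = 0"
  then have "AE z in lborel. indicator ?A z * ennreal (norm z powr s) = 0"
    by (subst (asm) nn_integral_0_iff_AE) auto
  \<comment> \<open>The ball of radius \<open>1/4\<close> about \<open>3/4\<close> lies in the
    annulus and has positive measure, while the weight is positive on it.\<close>
  then have "AE z in lborel. z \<notin> ball (3/4::complex) (1/4)"
  proof eventually_elim
    case (elim z)
    show ?case
    proof
      assume "z \<in> ball (3/4::complex) (1/4)"
      then have z: "norm (3/4 - z) < 1/4"
        by (simp add: dist_norm)
      have "norm (3/4::complex) \<le> norm (3/4 - z) + norm z" "norm z \<le> norm (3/4 - z) + norm (3/4::complex)"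
        by norm+
      then have "z \<in> ?A"
        using z by (simp add: norm_divide)
      then show False
        using elim by auto
    qed
  qed
  then have "emeasure lborel (ball (3/4::complex) (1/4)) = 0"
    by (subst (asm) AE_iff_measurable[of "ball (3/4::complex) (1/4)"]) auto
  then show False
    using content_ball_pos[of "1/4" "3/4::complex"] by (simp add: measure_def)
qed

lemma disc_weight_split:
  "disc_weight s 1 = disc_weight s (1/2) +
    (\<integral>\<^sup>+z. indicator {z::complex. 1/2 \<le> norm z \<and> norm z < 1} z * ennreal (norm z powr s) \<partial>lborel)"
  unfolding disc_weight_def
  by (subst nn_integral_add[symmetric]) (auto intro!: nn_integral_cong simp: indicator_def)

lemma disc_weight_nonzero: "disc_weight s 1 \<noteq> 0"
  using annulus_weight_nonzero[of s] disc_weight_split[of s] by auto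

lemma disc_weight_infinite:
  assumes "s \<le> -2"
  shows "disc_weight s 1 = \<infinity>"
proof (rule ccontr)
  define Y where "Y = (\<integral>\<^sup>+z. indicator {z::complex. 1/2 \<le> norm z \<and> norm z < 1} z * ennreal (norm z powr s) \<partial>lborel)"
  assume fin: "disc_weight s 1 \<noteq> \<infinity>"
  \<comment> \<open>The disc of radius 1/2 then has at least the weight of the unit disc, leaving none for the annulus.\<close>
  have "(1::real) = (1/2) powr 0"
    by simp
  also have "\<dots> \<le> (1/2) powr (s + 2)"
    using assms by (intro powr_mono') auto
  finally have "1 * disc_weight s 1 \<le> ennreal ((1/2) powr (s + 2)) * disc_weight s 1"
    by (intro mult_right_mono) (auto simp: ennreal_leI simp flip: ennreal_1)
  also have "\<dots> = disc_weight s (1/2)"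
    by (rule disc_weight_scale[symmetric]) simp
  finally have "disc_weight s 1 + Y \<le> disc_weight s 1 + 0"
    using disc_weight_split[of s] by (simp add: Y_def add_mono)
  then have "Y = 0"
    using fin by (metis ennreal_add_left_cancel_le infinity_ennreal_def le_zero_eq)
  then show False
    using annulus_weight_nonzero[of s] by (simp add: Y_def)
qed

text \<open>Dyadic decomposition: on the shell where \<open>norm z\<close> is about
  \<open>2 powr (- n)\<close> the weight is comparable to \<open>2 powr (- s * n)\<close>, and the
  disc containing the shell has area proportional to \<open>4 powr (- n)\<close>. The sum is
  geometric with ratio \<open>q < 1\<close>.\<close>

lemma disc_weight_finite:
  assumes s: "s > -2"
  shows "disc_weight s 1 < \<infinity>"
proof -
  define K where "K = 2 powr \<bar>s\<bar> * unit_ball_vol 2"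
  define q where "q = (2::real) powr (-(s + 2))"
  have K: "K \<ge> 0"
    by (simp add: K_def)
  have q: "0 < q" "q < 1"
    using s by (auto simp: q_def powr_less_one)
  \<comment> \<open>The factor \<open>2 powr \<bar>s\<bar>\<close> absorbs the variation of the
    weight on one dyadic shell, whatever the sign of \<open>s\<close>.\<close>
  define f where "f n z = ennreal (2 powr \<bar>s\<bar> * 2 powr (- s * real n)) * indicator (cball (0::complex) (2 powr (- real n))) z" for n z
  have pt: "indicator {z::complex. norm z < 1} z * ennreal (norm z powr s) \<le> (\<Sum>n. f n z)" for z
  proof (cases "z \<noteq> 0 \<and> norm z < 1")
    case True
    define L where "L = - log 2 (norm z)"
    define n where "n = nat \<lfloor>L\<rfloor>"
    have L: "L > 0"
      using True by (simp add: L_def)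
    have n: "real n \<le> L" "L < real n + 1"
      using L unfolding n_def by linarith+
    have z: "norm z = 2 powr (- L)"
      using True by (simp add: L_def)
    have "(- s) * (L - real n) \<le> \<bar>s\<bar> * (L - real n)"
      using n(1) by (intro mult_right_mono) auto
    also have "\<dots> \<le> \<bar>s\<bar> * 1"
      using n(2) by (intro mult_left_mono) auto
    finally have "- L * s \<le> \<bar>s\<bar> + - s * real n"
      by (simp add: algebra_simps)
    then have "norm z powr s \<le> 2 powr (\<bar>s\<bar> + - s * real n)"
      unfolding z powr_powr by (intro powr_mono) auto
    then have "norm z powr s \<le> 2 powr \<bar>s\<bar> * 2 powr (- s * real n)"
      by (simp only: powr_add)
    moreover have "norm z \<le> 2 powr (- real n)"
      unfolding z using n by (intro powr_mono) auto
    ultimately have "indicator {z::complex. norm z < 1} z * ennreal (norm z powr s) \<le> f n z"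
      using True by (simp add: f_def ennreal_leI)
    also have "\<dots> \<le> (\<Sum>n. f n z)"
      using sum_le_suminf[of "\<lambda>n. f n z" "{n}"] by simp
    finally show ?thesis .
  qed auto
  have "disc_weight s 1 \<le> (\<integral>\<^sup>+z. (\<Sum>n. f n z) \<partial>lborel)"
    unfolding disc_weight_def by (intro nn_integral_mono pt)
  also have "\<dots> = (\<Sum>n. \<integral>\<^sup>+z. f n z \<partial>lborel)"
  proof (rule nn_integral_suminf)
    show "f n \<in> borel_measurable lborel" for n
      unfolding f_def by (intro borel_measurable_times_ennreal borel_measurable_const borel_measurable_indicator) simp
  qed
  also have "\<dots> = (\<Sum>n. ennreal (K * q ^ n))"
  proof (rule suminf_cong)
    fix n
    have "(\<integral>\<^sup>+z. f n z \<partial>lborel) = ennreal (2 powr \<bar>s\<bar> * 2 powr (- s * real n)) * ennreal (unit_ball_vol 2 * (2 powr (- real n))^2)"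
      unfolding f_def by (subst nn_integral_cmult_indicator) (simp_all add: emeasure_cball)
    also have "\<dots> = ennreal (K * (2 powr (- s * real n) * (2 powr (- real n))^2))"
      by (simp add: K_def ennreal_mult[symmetric] mult_ac)
    also have "2 powr (- s * real n) * (2 powr (- real n))^2 = (2::real) powr (- (s + 2) * real n)"
      by (simp only: power2_eq_square powr_add[symmetric]) (simp add: algebra_simps)
    also have "\<dots> = q ^ n"
      unfolding powr_realpow[OF q(1), symmetric] by (simp only: q_def powr_powr)
    finally show "(\<integral>\<^sup>+z. f n z \<partial>lborel) = ennreal (K * q ^ n)" .
  qed
  also have "\<dots> = ennreal (\<Sum>n. K * q ^ n)"
  proof (rule suminf_ennreal2)
    show "0 \<le> K * q ^ n" for n
      using K q by simp
    show "summable (\<lambda>n. K * q ^ n)"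
      using q by (intro summable_mult summable_geometric) simp
  qed
  also have "\<dots> < \<infinity>"
    by simp
  finally show ?thesis .
qed

text \<open>By Tonelli the inner integral is over a disc of radius
  \<open>norm y powr (1/\<gamma>)\<close>; scaling it to the unit disc adds
  \<open>(s + 2) / \<gamma>\<close> to the exponent of \<open>norm y\<close>.\<close>

lemma nn_integral_Hgamma_weight:
  assumes \<gamma>: "\<gamma> > 0"
  shows "(\<integral>\<^sup>+w. indicator (Hgamma \<gamma>) w * ennreal (norm (fst w) powr s * norm (snd w) powr t) \<partial>lborel)
    = disc_weight s 1 * disc_weight (t + (s + 2) / \<gamma>) 1"
proof -
  have [measurable]: "Hgamma \<gamma> \<in> sets (borel \<Otimes>\<^sub>M borel)"
    unfolding borel_prod using borel_open[OF open_Hgamma[OF \<gamma>]] .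
  let ?F = "\<lambda>x y. indicator (Hgamma \<gamma>) (x, y) * ennreal (norm x powr s * norm y powr t)"
  have "(\<integral>\<^sup>+w. indicator (Hgamma \<gamma>) w * ennreal (norm (fst w) powr s * norm (snd w) powr t) \<partial>lborel)
      = (\<integral>\<^sup>+y. \<integral>\<^sup>+x. ?F x y \<partial>lborel \<partial>lborel)"
    by (simp add: lborel_prod[symmetric] lborel_pair.nn_integral_snd[symmetric])
  also have "\<dots> = (\<integral>\<^sup>+y. indicator {y::complex. norm y < 1} y * ennreal (norm y powr (t + (s + 2) / \<gamma>)) * disc_weight s 1 \<partial>lborel)"
  proof (rule nn_integral_cong)
    fix y :: complex
    show "(\<integral>\<^sup>+x. ?F x y \<partial>lborel) = indicator {y::complex. norm y < 1} y * ennreal (norm y powr (t + (s + 2) / \<gamma>)) * disc_weight s 1"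
    proof (cases "y = 0 \<or> norm y \<ge> 1")
      case True
      then have "?F x y = 0" for x
        by (auto simp: Hgamma_iff indicator_def)
      then have "(\<integral>\<^sup>+x. ?F x y \<partial>lborel) = (\<integral>\<^sup>+x. 0 \<partial>(lborel :: complex measure))"
        by (simp only:)
      then show ?thesis
        using True by auto
    next
      case False
      define R where "R = norm y powr (1/\<gamma>)"
      have R: "R > 0"
        using False by (simp add: R_def)
      have iff: "norm z < R \<longleftrightarrow> norm z powr \<gamma> < norm y" for z :: complex
        using powr_less_mono2[OF \<gamma>, of "norm z" R] powr_mono2[of \<gamma> R "norm z"] \<gamma>
        by (auto simp: R_def powr_powr not_less[symmetric])
      have "(\<integral>\<^sup>+x. ?F x y \<partial>lborel)
          = (\<integral>\<^sup>+x. ennreal (norm y powr t) * (indicator {x::complex. norm x < R} x * ennreal (norm x powr s)) \<partial>lborel)"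
        using False
        by (intro nn_integral_cong) (auto simp: Hgamma_iff indicator_def iff ennreal_mult[symmetric] mult_ac)
      also have "\<dots> = ennreal (norm y powr t) * disc_weight s R"
        unfolding disc_weight_def by (rule nn_integral_cmult) measurable
      also have "\<dots> = ennreal (norm y powr t) * ennreal (R powr (s + 2)) * disc_weight s 1"
        by (simp add: disc_weight_scale[OF R] mult.assoc)
      also have "ennreal (norm y powr t) * ennreal (R powr (s + 2)) = ennreal (norm y powr (t + (s + 2) / \<gamma>))"
        by (simp add: R_def powr_powr powr_add add_divide_distrib ennreal_mult[symmetric])
      finally show ?thesis
        using False by simp
    qed
  qed
  also have "\<dots> = disc_weight (t + (s + 2) / \<gamma>) 1 * disc_weight s 1"
    unfolding disc_weight_def[of "t + (s + 2) / \<gamma>"] by (rule nn_integral_multc) measurable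
  finally show ?thesis
    by (simp add: mult.commute)
qed

lemma norm_lmonom_powr:
  assumes "w \<in> Hgamma_punct \<gamma>"
  shows "norm (lmonom a b w) powr q = norm (fst w) powr (q * a) * norm (snd w) powr (q * b)"
proof -
  have "fst w \<noteq> 0" "snd w \<noteq> 0"
    using assms by (auto simp: Hgamma_punct_def dest: Hgamma_snd_nonzero)
  then show ?thesis
    by (simp add: lmonom_def norm_mult norm_power norm_power_int powr_mult powr_powr
        powr_realpow[symmetric] powr_real_of_int'[symmetric] mult.commute)
qed

text \<open>The integral is a product of two disc weights. The first is finite since
  \<open>q * a\<close> is nonnegative, and nonzero, so it cannot cancel an infinite second factor.
  The second is finite exactly when its exponent exceeds -2, which is the stated condition after
  multiplication by \<gamma>.\<close>

lemma lmonom_powr_integrable_iff: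
  assumes \<gamma>: "\<gamma> > 0" and q: "q \<ge> 0"
  shows "integrable lborel (\<lambda>w. indicator (Hgamma \<gamma>) w *\<^sub>R (norm (lmonom a b w) powr q))
    \<longleftrightarrow> - 2 * \<gamma> - 2 < q * (real a + real_of_int b * \<gamma>)"
proof -
  have [measurable]: "Hgamma \<gamma> \<in> sets borel"
    using open_Hgamma[OF \<gamma>] by simp
  have "(\<integral>\<^sup>+w. ennreal (norm (indicator (Hgamma \<gamma>) w *\<^sub>R (norm (lmonom a b w) powr q))) \<partial>lborel)
      = (\<integral>\<^sup>+w. indicator (Hgamma \<gamma>) w * ennreal (norm (fst w) powr (q * a) * norm (snd w) powr (q * b)) \<partial>lborel)"
    using AE_fst_nonzero
    by (intro nn_integral_cong_AE, eventually_elim)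
       (auto simp: indicator_def Hgamma_punct_def norm_lmonom_powr[of _ \<gamma>])
  also have "\<dots> = disc_weight (q * a) 1 * disc_weight (q * b + (q * a + 2) / \<gamma>) 1"
    by (rule nn_integral_Hgamma_weight[OF \<gamma>])
  finally have I: "(\<integral>\<^sup>+w. ennreal (norm (indicator (Hgamma \<gamma>) w *\<^sub>R (norm (lmonom a b w) powr q))) \<partial>lborel)
      = disc_weight (q * a) 1 * disc_weight (q * b + (q * a + 2) / \<gamma>) 1" .
  have 1: "disc_weight (q * a) 1 < \<infinity>"
    using q by (intro disc_weight_finite) (auto intro: less_le_trans[of _ 0])
  have "- 2 * \<gamma> - 2 < q * (real a + real_of_int b * \<gamma>) \<longleftrightarrow> -2 < q * b + (q * a + 2) / \<gamma>"
    using \<gamma> by (simp add: field_simps)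
  moreover have "disc_weight (q * a) 1 * disc_weight (q * b + (q * a + 2) / \<gamma>) 1 < \<infinity>
      \<longleftrightarrow> -2 < q * b + (q * a + 2) / \<gamma>"
  proof (cases "-2 < q * b + (q * a + 2) / \<gamma>")
    case True
    then show ?thesis
      using 1 disc_weight_finite[OF True] by (simp add: ennreal_mult_less_top)
  next
    case False
    then show ?thesis
      using disc_weight_infinite[of "q * b + (q * a + 2) / \<gamma>"] disc_weight_nonzero[of "q * a"]
      by (simp add: ennreal_mult_top)
  qed
  moreover have "(\<lambda>w. indicator (Hgamma \<gamma>) w *\<^sub>R (norm (lmonom a b w) powr q)) \<in> borel_measurable lborel"
    by measurable
  ultimately show ?thesis
    unfolding integrable_iff_bounded I by simp
qed

section \<open>Critical exponents close to 2\<close>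

text \<open>By density of fractional parts, \<open>k * \<gamma> - h\<close> can be made slightly
  negative. The exponents \<open>a = h - 1\<close>, \<open>b = - (k + 1)\<close> then have
  \<open>a + b * \<gamma> = - x\<close> with \<open>x\<close> slightly below
  \<open>\<gamma> + 1\<close>, so \<open>q = (2 * \<gamma> + 2) / x\<close> is slightly above
  2.\<close>

lemma exists_critical_exponent:
  fixes \<gamma> P :: real
  assumes \<gamma>: "\<gamma> > 0" "\<gamma> \<notin> \<rat>" and P: "P > 2"
  obtains a :: nat and b :: int and q :: real
  where "2 < q" "q < P" "q * (real a + real_of_int b * \<gamma>) = - 2 * \<gamma> - 2"
proof -
  \<comment> \<open>Chosen so that \<open>\<gamma> + 1 - d\<close> equals
    \<open>(\<gamma> + 1) * (2 / P)\<close>, the lower bound on \<open>x\<close> that is equivalent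
    to \<open>q < P\<close>.\<close>
  define d where "d = (\<gamma> + 1) * (1 - 2 / P)"
  have d: "d > 0"
    using \<gamma>(1) P by (simp add: d_def)
  obtain h k where hk: "k > 0" "\<bar>of_int k * \<gamma> - of_int h - (- d / 2)\<bar> < d / 2"
    by (rule sequence_of_fractional_parts_is_dense[OF \<gamma>(2), of "d / 2" "- d / 2"]) (use d in simp)
  define x where "x = \<gamma> + 1 + (of_int k * \<gamma> - of_int h)"
  have e: "- d < of_int k * \<gamma> - of_int h" "of_int k * \<gamma> - of_int h < 0"
    using hk(2) by linarith+
  have "0 < of_int k * \<gamma>"
    using hk(1) \<gamma>(1) by simp
  \<comment> \<open>Needed for \<open>h - 1\<close> to be a valid exponent of the first
    coordinate.\<close>
  then have h: "h \<ge> 1"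
    using e by linarith
  have x: "(\<gamma> + 1) * (2 / P) < x" "x < \<gamma> + 1"
    using e unfolding x_def d_def by (simp_all add: algebra_simps)
  then have x0: "x > 0"
    using \<gamma>(1) P by (smt (verit) divide_pos_pos mult_pos_pos)
  show ?thesis
  proof
    show "2 < (2 * \<gamma> + 2) / x" "(2 * \<gamma> + 2) / x < P"
      using x x0 P by (simp_all add: field_simps)
    have "real (nat (h - 1)) + real_of_int (- (k + 1)) * \<gamma> = - x"
      using h by (simp add: x_def algebra_simps)
    then show "(2 * \<gamma> + 2) / x * (real (nat (h - 1)) + real_of_int (- (k + 1)) * \<gamma>) = - 2 * \<gamma> - 2"
      using x0 by simp
  qed
qed

section \<open>Unboundedness for exponents other than 2\<close>

lemma borel_measurable_lebesgue_on [intro]: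
  fixes f :: "'a::euclidean_space \<Rightarrow> 'b::topological_space"
  assumes "f \<in> borel_measurable borel"
  shows "f \<in> borel_measurable (lebesgue_on S)"
  using assms by (intro measurable_restrict_space1 measurable_completion) simp

lemma lebesgue_on_lmonom_powr_integrable_iff:
  assumes \<gamma>: "\<gamma> > 0" and q: "q \<ge> 0"
  shows "integrable (lebesgue_on (Hgamma \<gamma>)) (\<lambda>w. norm (lmonom a b w) powr q)
    \<longleftrightarrow> - 2 * \<gamma> - 2 < q * (real a + real_of_int b * \<gamma>)"
proof -
  have [measurable]: "Hgamma \<gamma> \<in> sets borel"
    using open_Hgamma[OF \<gamma>] by simp
  show ?thesis
    by (subst lebesgue_on_integral_borel(1)) (measurable, rule lmonom_powr_integrable_iff[OF assms])
qed

lemma lebesgue_on_lmonom_coefficient: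
  assumes \<gamma>: "\<gamma> > 0" and g: "holo2 g (Hgamma \<gamma>)"
  obtains C :: complex where
    "\<And>\<rho> :: complex \<times> complex \<Rightarrow> real. \<rho> \<in> borel_measurable borel \<Longrightarrow>
      (\<And>u v x y. norm u = 1 \<Longrightarrow> norm v = 1 \<Longrightarrow> \<rho> (u * x, v * y) = \<rho> (x, y)) \<Longrightarrow>
      integrable (lebesgue_on (Hgamma \<gamma>)) (\<lambda>w. g w * cnj (lmonom a b w) * of_real (\<rho> w)) \<Longrightarrow>
      integrable (lebesgue_on (Hgamma \<gamma>)) (\<lambda>w. C * of_real ((norm (lmonom a b w))\<^sup>2 * \<rho> w)) \<and>
      (\<integral>w. g w * cnj (lmonom a b w) * of_real (\<rho> w) \<partial>lebesgue_on (Hgamma \<gamma>))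
        = C * of_real (\<integral>w. (norm (lmonom a b w))\<^sup>2 * \<rho> w \<partial>lebesgue_on (Hgamma \<gamma>))"
proof -
  have [measurable]: "Hgamma \<gamma> \<in> sets borel"
    using open_Hgamma[OF \<gamma>] by simp
  have [measurable]: "(\<lambda>w. indicator (Hgamma \<gamma>) w *\<^sub>R g w) \<in> borel_measurable borel"
    by (intro borel_measurable_indicator_continuous_on open_Hgamma \<gamma> holo2_imp_continuous_on g)
  obtain C where C: "\<And>\<rho> :: complex \<times> complex \<Rightarrow> real. \<rho> \<in> borel_measurable borel \<Longrightarrow>
      (\<And>u v x y. norm u = 1 \<Longrightarrow> norm v = 1 \<Longrightarrow> \<rho> (u * x, v * y) = \<rho> (x, y)) \<Longrightarrow>
      integrable lborel (\<lambda>w. indicator (Hgamma \<gamma>) w *\<^sub>R (g w * cnj (lmonom a b w) * of_real (\<rho> w))) \<Longrightarrow>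
      integrable lborel (\<lambda>w. indicator (Hgamma \<gamma>) w *\<^sub>R (C * of_real ((norm (lmonom a b w))\<^sup>2 * \<rho> w))) \<and>
      (\<integral>w. indicator (Hgamma \<gamma>) w *\<^sub>R (g w * cnj (lmonom a b w) * of_real (\<rho> w)) \<partial>lborel)
        = (\<integral>w. indicator (Hgamma \<gamma>) w *\<^sub>R (C * of_real ((norm (lmonom a b w))\<^sup>2 * \<rho> w)) \<partial>lborel)"
    using lmonom_coefficient[OF \<gamma> g] by blast
  show ?thesis
  proof (rule that)
    fix \<rho> :: "complex \<times> complex \<Rightarrow> real"
    assume \<rho>[measurable]: "\<rho> \<in> borel_measurable borel"
      and inv: "\<And>u v x y. norm u = 1 \<Longrightarrow> norm v = 1 \<Longrightarrow> \<rho> (u * x, v * y) = \<rho> (x, y)"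
      and int: "integrable (lebesgue_on (Hgamma \<gamma>)) (\<lambda>w. g w * cnj (lmonom a b w) * of_real (\<rho> w))"
    have "(\<lambda>w. (indicator (Hgamma \<gamma>) w *\<^sub>R g w) * (cnj (lmonom a b w) * of_real (\<rho> w))) \<in> borel_measurable borel"
      by measurable
    then have m1: "(\<lambda>w. indicator (Hgamma \<gamma>) w *\<^sub>R (g w * cnj (lmonom a b w) * of_real (\<rho> w))) \<in> borel_measurable borel"
      by (simp add: mult.assoc)
    have m2: "(\<lambda>w. indicator (Hgamma \<gamma>) w *\<^sub>R (C * of_real ((norm (lmonom a b w))\<^sup>2 * \<rho> w))) \<in> borel_measurable borel"
      by measurable
    have S: "Hgamma \<gamma> \<in> sets borel"
      by simp
    note 1 = lebesgue_on_integral_borel[OF S m1] and 2 = lebesgue_on_integral_borel[OF S m2]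
    have "integrable (lebesgue_on (Hgamma \<gamma>)) (\<lambda>w. C * of_real ((norm (lmonom a b w))\<^sup>2 * \<rho> w)) \<and>
      (\<integral>w. g w * cnj (lmonom a b w) * of_real (\<rho> w) \<partial>lebesgue_on (Hgamma \<gamma>))
        = (\<integral>w. C * of_real ((norm (lmonom a b w))\<^sup>2 * \<rho> w) \<partial>lebesgue_on (Hgamma \<gamma>))"
      unfolding 2 1(2) by (rule C[OF \<rho> inv int[unfolded 1(1)]])
    then show "integrable (lebesgue_on (Hgamma \<gamma>)) (\<lambda>w. C * of_real ((norm (lmonom a b w))\<^sup>2 * \<rho> w)) \<and>
      (\<integral>w. g w * cnj (lmonom a b w) * of_real (\<rho> w) \<partial>lebesgue_on (Hgamma \<gamma>))
        = C * of_real (\<integral>w. (norm (lmonom a b w))\<^sup>2 * \<rho> w \<partial>lebesgue_on (Hgamma \<gamma>))"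
      by (simp only: integral_mult_right_zero integral_complex_of_real)
  qed
qed

lemma finite_measure_Hgamma:
  assumes "\<gamma> > 0"
  shows "finite_measure (lebesgue_on (Hgamma \<gamma>))"
proof (rule finite_measureI)
  have "Hgamma \<gamma> \<subseteq> cball 0 1 \<times> cball 0 1"
  proof
    fix w assume w: "w \<in> Hgamma \<gamma>"
    then have "norm (fst w) powr \<gamma> < 1"
      by (simp add: Hgamma_iff)
    then have "norm (fst w) \<le> 1"
      using powr_mono2[of \<gamma> 1 "norm (fst w)"] assms by (cases "norm (fst w) \<le> 1") auto
    with w show "w \<in> cball 0 1 \<times> cball 0 1"
      by (auto simp: Hgamma_iff mem_Times_iff)
  qed
  then have "bounded (Hgamma \<gamma>)"
    by (rule bounded_subset[rotated]) (intro bounded_Times bounded_cball)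
  then have "Hgamma \<gamma> \<in> lmeasurable"
    using assms by (intro lmeasurable_open open_Hgamma)
  then show "emeasure (lebesgue_on (Hgamma \<gamma>)) (space (lebesgue_on (Hgamma \<gamma>))) \<noteq> \<infinity>"
    by (simp add: space_restrict_space emeasure_restrict_space fmeasurable_def less_top del: emeasure_completion)
qed

lemma Ap2_lmonom:
  assumes \<gamma>: "\<gamma> > 0" and "- 2 * \<gamma> - 2 < 2 * (real a + real_of_int b * \<gamma>)"
  shows "Ap 2 (Hgamma \<gamma>) (lmonom a b)"
  unfolding Ap_def Lp_def
  using lebesgue_on_lmonom_powr_integrable_iff[OF \<gamma>, of 2 a b] assms(2)
  by (auto intro: holo2_lmonom)

text \<open>Both unboundedness proofs use this form. The weighted degree \<open>x\<close> of the
  monomial is negative, so comparing \<open>r * x\<close> with \<open>q * x\<close> reverses the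
  order and integrability becomes \<open>r < q\<close>.\<close>

lemma exists_critical_monomial:
  fixes \<gamma> P :: real
  assumes \<gamma>: "\<gamma> > 0" "\<gamma> \<notin> \<rat>" and P: "P > 2"
  obtains a b q where "2 < q" "q < P" "Ap 2 (Hgamma \<gamma>) (lmonom a b)"
    "\<And>r. r \<ge> 0 \<Longrightarrow> integrable (lebesgue_on (Hgamma \<gamma>)) (\<lambda>w. norm (lmonom a b w) powr r) \<longleftrightarrow> r < q"
proof -
  obtain a :: nat and b :: int and q :: real
    where q: "2 < q" "q < P" and crit: "q * (real a + real_of_int b * \<gamma>) = - 2 * \<gamma> - 2"
    using exists_critical_exponent[OF \<gamma> P] .
  define M where "M = lebesgue_on (Hgamma \<gamma>)"
  define x where "x = real a + real_of_int b * \<gamma>"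
  have x: "x < 0"
    using crit q(1) \<gamma>(1) by (smt (verit) mult_nonneg_nonneg x_def)
  have ints: "integrable M (\<lambda>w. norm (lmonom a b w) powr r) \<longleftrightarrow> r < q" if "r \<ge> 0" for r
    using x crit unfolding M_def lebesgue_on_lmonom_powr_integrable_iff[OF \<gamma>(1) that] x_def[symmetric]
    by (metis mult_less_cancel_right_disj not_less_iff_gr_or_eq)
  have e: "Ap 2 (Hgamma \<gamma>) (lmonom a b)"
  proof (rule Ap2_lmonom[OF \<gamma>(1)])
    have "q * x < 2 * x"
      using x q by simp
    then show "- 2 * \<gamma> - 2 < 2 * (real a + real_of_int b * \<gamma>)"
      using crit by (simp add: x_def)
  qed
  show ?thesis
    using that[OF q e] ints by (simp add: M_def)
qed

lemma Hgamma_punct_nonempty: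
  assumes "\<gamma> > 0"
  obtains z where "z \<in> Hgamma_punct \<gamma>"
proof
  have "((1/4) powr (1/\<gamma>)) powr \<gamma> = (1/4::real)"
    using assms by (simp add: powr_powr)
  then show "(complex_of_real ((1/4) powr (1/\<gamma>)), 1/2) \<in> Hgamma_punct \<gamma>"
    by (simp add: Hgamma_punct_def Hgamma_iff norm_divide)
qed

text \<open>The contradiction arises from the integrability clause of boundedness at a single point
  \<open>z\<close> off the axis, where the monomial does not vanish.\<close>

lemma bergman_unbounded_small:
  fixes \<gamma> p :: real
  assumes \<gamma>: "\<gamma> > 0" "\<gamma> \<notin> \<rat>" and p: "1 < p" "p < 2"
  shows "\<not> bergman_Lp_bounded p (Hgamma \<gamma>)"
proof
  assume bdd: "bergman_Lp_bounded p (Hgamma \<gamma>)"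
  let ?M = "lebesgue_on (Hgamma \<gamma>)"
  note \<Omega> = open_Hgamma[OF \<gamma>(1)]
  have "p / (p - 1) > 2"
    using p by (simp add: field_simps)
  from exists_critical_monomial[OF \<gamma> this] obtain a b q
    where q: "2 < q" "q < p / (p - 1)" and e: "Ap 2 (Hgamma \<gamma>) (lmonom a b)"
      and ints: "\<And>r. r \<ge> 0 \<Longrightarrow> integrable ?M (\<lambda>w. norm (lmonom a b w) powr r) \<longleftrightarrow> r < q"
    by metis
  obtain z where z: "z \<in> Hgamma_punct \<gamma>"
    using Hgamma_punct_nonempty[OF \<gamma>(1)] .
  then have z': "z \<in> Hgamma \<gamma>"
    by (simp add: Hgamma_punct_def)
  define K where "K = bergman_kernel (Hgamma \<gamma>) z"
  define k where "k w = cnj (K w)" for w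
  have k: "Ap 2 (Hgamma \<gamma>) k" "L2ip (Hgamma \<gamma>) (lmonom a b) k = lmonom a b z"
    using bergman_kernel_reproducing(1)[OF \<Omega> z'] bergman_kernel_reproducing(2)[OF \<Omega> z' e]
    by (simp_all add: k_def[abs_def] K_def)
  have km[measurable]: "k \<in> borel_measurable ?M"
    using k(1) by (simp add: Ap_def Lp_def)
  define f where "f w = complex_of_real (norm (lmonom a b w) powr (q - 1))" for w
  have "Lp p (Hgamma \<gamma>) f"
    unfolding Lp_def
  proof
    show "f \<in> borel_measurable ?M"
      unfolding f_def by (rule borel_measurable_lebesgue_on) measurable
    \<comment> \<open>Equivalent to \<open>q\<close> being below the conjugate exponent
      \<open>p / (p - 1)\<close>.\<close>
    have "(q - 1) * p < q"
      using q p by (simp add: field_simps)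
    then show "integrable ?M (\<lambda>w. norm (f w) powr p)"
      using ints[of "(q - 1) * p"] q p by (simp add: f_def powr_powr)
  qed
  then have Kf: "integrable ?M (\<lambda>w. K w * f w)"
    using bdd z' unfolding bergman_Lp_bounded_def K_def by blast
  \<comment> \<open>The weight turns the monomial into \<open>f\<close> in modulus, and its squared
    modulus into the non-integrable power \<open>q\<close>.\<close>
  define \<rho> where "\<rho> w = norm (lmonom a b w) powr (q - 2)" for w
  have \<rho>m[measurable]: "\<rho> \<in> borel_measurable borel"
    unfolding \<rho>_def by measurable
  have em[measurable]: "lmonom a b \<in> borel_measurable ?M" "\<rho> \<in> borel_measurable ?M"
    by (intro borel_measurable_lebesgue_on; measurable)+
  have pw: "r * r powr (q - 2) = r powr (q - 1)" "r\<^sup>2 * r powr (q - 2) = r powr q" if "r \<ge> 0" for r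
    using that q by (cases "r = 0"; simp add: powr_diff powr_numeral power2_eq_square)+
  have int\<rho>: "integrable ?M (\<lambda>w. k w * cnj (lmonom a b w) * of_real (\<rho> w))"
  proof (rule Bochner_Integration.integrable_bound[OF Kf])
    show "AE w in ?M. norm (k w * cnj (lmonom a b w) * complex_of_real (\<rho> w)) \<le> norm (K w * f w)"
      using pw(1) by (intro AE_I2) (simp add: k_def f_def \<rho>_def norm_mult mult.assoc)
  qed measurable
  obtain C where C: "\<And>\<rho> :: complex \<times> complex \<Rightarrow> real. \<rho> \<in> borel_measurable borel \<Longrightarrow>
      (\<And>u v x y. norm u = 1 \<Longrightarrow> norm v = 1 \<Longrightarrow> \<rho> (u * x, v * y) = \<rho> (x, y)) \<Longrightarrow>
      integrable ?M (\<lambda>w. k w * cnj (lmonom a b w) * of_real (\<rho> w)) \<Longrightarrow>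
      integrable ?M (\<lambda>w. C * of_real ((norm (lmonom a b w))\<^sup>2 * \<rho> w)) \<and>
      (\<integral>w. k w * cnj (lmonom a b w) * of_real (\<rho> w) \<partial>?M)
        = C * of_real (\<integral>w. (norm (lmonom a b w))\<^sup>2 * \<rho> w \<partial>?M)"
    using lebesgue_on_lmonom_coefficient[OF \<gamma>(1), of k a b] k(1) unfolding Ap_def by blast
  \<comment> \<open>The weight 1 identifies \<open>C\<close> through the reproducing property: it is
    nonzero because the monomial is nonzero at \<open>z\<close>. The same \<open>C\<close> is then
    used with \<open>\<rho>\<close>.\<close>
  have "L2ip (Hgamma \<gamma>) k (lmonom a b) = C * of_real (\<integral>w. (norm (lmonom a b w))\<^sup>2 \<partial>?M)"
    using C[of "\<lambda>_. 1"] Lp2_mult_integrable[OF Ap2_Lp[OF k(1)] Ap2_Lp[OF e]]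
    by (simp add: L2ip_def)
  moreover have "L2ip (Hgamma \<gamma>) k (lmonom a b) = cnj (lmonom a b z)"
    by (simp add: L2ip_commute[of _ k] k(2))
  ultimately have "C \<noteq> 0"
    using lmonom_nonzero[OF z, of a b] by auto
  have "integrable ?M (\<lambda>w. C * of_real ((norm (lmonom a b w))\<^sup>2 * \<rho> w))"
    by (rule C[THEN conjunct1, OF \<rho>m _ int\<rho>]) (simp add: \<rho>_def norm_lmonom_rotate)
  then have "integrable ?M (\<lambda>w. norm (C * of_real ((norm (lmonom a b w))\<^sup>2 * \<rho> w)))"
    by (rule integrable_norm)
  also have "(\<lambda>w. norm (C * of_real ((norm (lmonom a b w))\<^sup>2 * \<rho> w))) = (\<lambda>w. norm C * norm (lmonom a b w) powr q)"
    using pw(2) by (simp add: norm_mult \<rho>_def abs_mult fun_eq_iff)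
  finally have "integrable ?M (\<lambda>w. norm (lmonom a b w) powr q)"
    using \<open>C \<noteq> 0\<close> by simp
  then show False
    using ints[of q] q by simp
qed

text \<open>The bounded function \<open>f\<close> lies in every space because the domain has finite
  measure, but its projection is a nonzero multiple of a monomial whose power \<open>p > q\<close>
  is not integrable.\<close>

lemma bergman_unbounded_large:
  fixes \<gamma> p :: real
  assumes \<gamma>: "\<gamma> > 0" "\<gamma> \<notin> \<rat>" and p: "2 < p"
  shows "\<not> bergman_Lp_bounded p (Hgamma \<gamma>)"
proof
  assume bdd: "bergman_Lp_bounded p (Hgamma \<gamma>)"
  let ?M = "lebesgue_on (Hgamma \<gamma>)"
  note \<Omega> = open_Hgamma[OF \<gamma>(1)]
  interpret finite_measure ?M
    by (rule finite_measure_Hgamma[OF \<gamma>(1)])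
  obtain a b q where q: "2 < q" "q < p" and e: "Ap 2 (Hgamma \<gamma>) (lmonom a b)"
      and ints: "\<And>r. r \<ge> 0 \<Longrightarrow> integrable ?M (\<lambda>w. norm (lmonom a b w) powr r) \<longleftrightarrow> r < q"
    using exists_critical_monomial[OF \<gamma> p] by metis
  have em[measurable]: "lmonom a b \<in> borel_measurable ?M"
    by (intro borel_measurable_lebesgue_on; measurable)
  \<comment> \<open>A zero integral would make the monomial vanish almost everywhere, and then even
    its power \<open>q\<close> would be integrable.\<close>
  have pos: "(\<integral>w. norm (lmonom a b w) powr r \<partial>?M) > 0" if r: "0 < r" "r < q" for r
  proof -
    have i: "integrable ?M (\<lambda>w. norm (lmonom a b w) powr r)"
      using ints r by simp
    have "(\<integral>w. norm (lmonom a b w) powr r \<partial>?M) \<noteq> 0"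
    proof
      assume "(\<integral>w. norm (lmonom a b w) powr r \<partial>?M) = 0"
      then have "AE w in ?M. norm (lmonom a b w) powr r = 0"
        using integral_nonneg_eq_0_iff_AE[OF i] by simp
      then have "AE w in ?M. norm (lmonom a b w) powr q = 0"
        by eventually_elim simp
      then have "integrable ?M (\<lambda>w. norm (lmonom a b w) powr q)"
        by (subst integrable_cong_AE[where g="\<lambda>_. 0"]) auto
      then show False
        using ints[of q] q by simp
    qed
    moreover have "(\<integral>w. norm (lmonom a b w) powr r \<partial>?M) \<ge> 0"
      by simp
    ultimately show ?thesis
      by linarith
  qed
  \<comment> \<open>At zeros of the monomial \<open>inverse 0 = 0\<close>, so \<open>f\<close> is 0
    there and the bound by 1 holds everywhere.\<close>
  define \<rho> where "\<rho> w = inverse (norm (lmonom a b w))" for w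
  define f where "f w = lmonom a b w * of_real (\<rho> w)" for w
  have \<rho>m[measurable]: "\<rho> \<in> borel_measurable borel"
    unfolding \<rho>_def by measurable
  have fm: "f \<in> borel_measurable ?M"
    unfolding f_def by (rule borel_measurable_lebesgue_on) measurable
  have f1: "norm (f w) \<le> 1" for w
    by (cases "lmonom a b w = 0") (simp_all add: f_def \<rho>_def norm_mult norm_inverse)
  have f: "Lp r (Hgamma \<gamma>) f" if "r > 0" for r
    unfolding Lp_def
  proof
    show "integrable ?M (\<lambda>w. norm (f w) powr r)"
    proof (rule integrable_const_bound[where B=1])
      show "AE w in ?M. norm (norm (f w) powr r) \<le> 1"
        using f1 powr_mono2[of r _ 1] that by (intro AE_I2) auto
      show "(\<lambda>w. norm (f w) powr r) \<in> borel_measurable ?M"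
        using fm by measurable
    qed
  qed (rule fm)
  \<comment> \<open>Pairing \<open>f\<close> with the monomial forces this ratio as the coefficient
    of the projection.\<close>
  define c where "c = (\<integral>w. norm (lmonom a b w) powr 1 \<partial>?M) / (\<integral>w. norm (lmonom a b w) powr 2 \<partial>?M)"
  have c: "c > 0"
    unfolding c_def using pos[of 1] pos[of 2] q by simp
  define h where "h w = of_real c * lmonom a b w" for w
  have h: "Ap 2 (Hgamma \<gamma>) h"
    unfolding h_def using Ap2_lincomb[OF e e, of "of_real c" 0] by simp
  have "bergman_proj (Hgamma \<gamma>) f z = h z" if z: "z \<in> Hgamma \<gamma>" for z
  proof (rule bergman_proj_eqI[OF \<Omega> z h])
    fix g assume g: "Ap 2 (Hgamma \<gamma>) g"
    obtain C where C: "\<And>\<rho> :: complex \<times> complex \<Rightarrow> real. \<rho> \<in> borel_measurable borel \<Longrightarrow>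
        (\<And>u v x y. norm u = 1 \<Longrightarrow> norm v = 1 \<Longrightarrow> \<rho> (u * x, v * y) = \<rho> (x, y)) \<Longrightarrow>
        integrable ?M (\<lambda>w. g w * cnj (lmonom a b w) * of_real (\<rho> w)) \<Longrightarrow>
        integrable ?M (\<lambda>w. C * of_real ((norm (lmonom a b w))\<^sup>2 * \<rho> w)) \<and>
        (\<integral>w. g w * cnj (lmonom a b w) * of_real (\<rho> w) \<partial>?M)
          = C * of_real (\<integral>w. (norm (lmonom a b w))\<^sup>2 * \<rho> w \<partial>?M)"
      using lebesgue_on_lmonom_coefficient[OF \<gamma>(1), of g a b] g unfolding Ap_def by blast
    have "L2ip (Hgamma \<gamma>) g f = (\<integral>w. g w * cnj (lmonom a b w) * of_real (\<rho> w) \<partial>?M)"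
      by (simp add: L2ip_def f_def mult.assoc)
    also have "\<dots> = C * of_real (\<integral>w. (norm (lmonom a b w))\<^sup>2 * \<rho> w \<partial>?M)"
    proof (rule C[THEN conjunct2, OF \<rho>m])
      show "integrable ?M (\<lambda>w. g w * cnj (lmonom a b w) * of_real (\<rho> w))"
        using Lp2_mult_integrable[OF Ap2_Lp[OF g] f[of 2]] by (simp add: f_def mult.assoc)
    qed (simp add: \<rho>_def norm_lmonom_rotate)
    also have "(\<lambda>w. (norm (lmonom a b w))\<^sup>2 * \<rho> w) = (\<lambda>w. norm (lmonom a b w) powr 1)"
      by (simp add: \<rho>_def power2_eq_square fun_eq_iff field_simps)
    also have "C * of_real (\<integral>w. norm (lmonom a b w) powr 1 \<partial>?M)
        = of_real c * (C * of_real (\<integral>w. norm (lmonom a b w) powr 2 \<partial>?M))"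
      using pos[of 2] q by (simp add: c_def)
    \<comment> \<open>The same \<open>C\<close> is used with weight 1, so the pairing of
      \<open>g\<close> with \<open>f\<close> is \<open>c\<close> times its pairing with the
      monomial.\<close>
    also have "C * of_real (\<integral>w. norm (lmonom a b w) powr 2 \<partial>?M) = L2ip (Hgamma \<gamma>) g (lmonom a b)"
      using C[of "\<lambda>_. 1"] Lp2_mult_integrable[OF Ap2_Lp[OF g] Ap2_Lp[OF e]]
      by (simp add: L2ip_def)
    also have "of_real c * L2ip (Hgamma \<gamma>) g (lmonom a b) = L2ip (Hgamma \<gamma>) g h"
      by (simp add: L2ip_def h_def mult.left_commute)
    finally show "L2ip (Hgamma \<gamma>) g f = L2ip (Hgamma \<gamma>) g h" .
  qed
  moreover have "Ap p (Hgamma \<gamma>) (bergman_proj (Hgamma \<gamma>) f)"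
    using bdd f[of p] p unfolding bergman_Lp_bounded_def by auto
  ultimately have "Ap p (Hgamma \<gamma>) h"
    using Ap_cong[OF \<Omega>] by blast
  then have "integrable ?M (\<lambda>w. c powr p * norm (lmonom a b w) powr p)"
    using c by (simp add: Ap_def Lp_def h_def norm_mult powr_mult)
  then have "integrable ?M (\<lambda>w. norm (lmonom a b w) powr p)"
    using c by simp
  then show False
    using ints[of p] p q by simp
qed

theorem theorem0p2:
  fixes \<gamma> p :: real
  assumes "\<gamma> > 0" and "\<gamma> \<notin> \<rat>" and "1 < p"
  shows "bergman_Lp_bounded p (Hgamma \<gamma>) \<longleftrightarrow> p = 2"
  using bergman_Lp_bounded_2[OF open_Hgamma[OF assms(1)]] bergman_unbounded_small[OF assms]
    bergman_unbounded_large[OF assms(1,2)]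
  by (metis linorder_neqE_linordered_idom)

end
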